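(* There exists a constant $c>0$ such that $L(n)\ge c\log\log n$ for almost all positive integers $n$; that is, $\#\{3\le n\le x : L(n)< c\log\log n\}=o(x)$ as $x\to\infty$.
   Context: The Carmichael function $\lambda(n)$ is the exponent of the multiplicative group $(\mathbb{Z}/n\mathbb{Z})^{\times}$. Its iterates are $\lambda_0(n)=n$ and $\lambda_k(n)=\lambda(\lambda_{k-1}(n))$ for $k\ge 1$. $L(n)$ denotes the smallest non-negative integer $k$ such that $\lambda_k(n)=1$. "Almost all $n$" means all $n$ in a set of positive integers of asymptotic density $1$. *)

theory Defs
  imports
    "HOL-Analysis.Analysis"
    "HOL-Library.Landau_Symbols"
    "HOL-Number_Theory.Number_Theory"
begin

definition carmichael_iter :: "nat \<Rightarrow> nat \<Rightarrow> nat" where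
  "carmichael_iter k n = (Carmichael ^^ k) n"

text \<open>
  The lemma \<open>carmichael_iter_reaches_1\<close> below shows that for positive \<open>n\<close> the least element
  is taken over a nonempty set.
\<close>

definition carmichael_L :: "nat \<Rightarrow> nat" where
  "carmichael_L n = (LEAST k. carmichael_iter k n = 1)"

lemma Carmichael_less:
  assumes "n > (1 :: nat)"
  shows   "Carmichael n < n"
proof -
  have "Carmichael n dvd totient n"
    by (rule Carmichael_dvd_totient)
  hence "Carmichael n \<le> totient n"
    using assms by (intro dvd_imp_le) auto
  also have "\<dots> < n"
    using assms by (rule totient_less)
  finally show ?thesis .
qed

lemma carmichael_iter_reaches_1:
  assumes "n > 0"
  shows   "\<exists>k. carmichael_iter k n = 1"
  using assms
proof (induction n rule: less_induct)
  case (less n)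
  show ?case
  proof (cases "n = 1")
    case True
    hence "carmichael_iter 0 n = 1"
      by (simp add: carmichael_iter_def)
    thus ?thesis ..
  next
    case False
    hence "Carmichael n < n"
      using less.prems by (intro Carmichael_less) auto
    then obtain k where "carmichael_iter k (Carmichael n) = 1"
      using less.IH[of "Carmichael n"] Carmichael_pos[of n] by auto
    hence "carmichael_iter (Suc k) n = 1"
      by (simp add: carmichael_iter_def funpow_swap1)
    thus ?thesis ..
  qed
qed

definition has_asymptotic_density :: "nat set \<Rightarrow> real \<Rightarrow> bool" where
  "has_asymptotic_density A d \<longleftrightarrow>
     (\<lambda>N. real (card (A \<inter> {1..N})) / real N) \<longlonglongrightarrow> d"

definition almost_all_nat :: "(nat \<Rightarrow> bool) \<Rightarrow> bool" where
  "almost_all_nat P \<longleftrightarrow>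
     (\<exists>A \<subseteq> {0<..}. has_asymptotic_density A 1 \<and> (\<forall>n\<in>A. P n))"

end

theory Submission
  imports
    Defs
    "HOL-Computational_Algebra.Squarefree"
    "HOL-Real_Asymp.Real_Asymp"
begin

text \<open>
  Put \<open>Q\<^sub>0 = {}\<close> and let \<open>Q\<^sub>k\<^sub>+\<^sub>1\<close> be the set of primes \<open>p\<close> such that all prime factors of \<open>p - 1\<close> lie in
  \<open>Q\<^sub>k\<close>. As \<open>p - 1\<close> divides \<open>\<lambda>(n)\<close> for every prime \<open>p\<close> dividing \<open>n\<close>, \<open>L(n) \<le> k\<close> forces all prime
  factors of \<open>n\<close> to lie in \<open>Q\<^sub>k\<close>. If the Euler product of \<open>1 + 1/q\<close> over \<open>Q\<^sub>k\<close> is at most \<open>E\<close>, then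
  an upper bound sieve (\<open>p\<close> is prime, and \<open>p - 1\<close> has no prime factor outside \<open>Q\<^sub>k\<close>) shows that
  \<open>Q\<^sub>k\<^sub>+\<^sub>1\<close> has \<open>O(E x / log\<^sup>2 x)\<close> elements up to \<open>x\<close>. Hence the primes of \<open>Q\<^sub>k\<^sub>+\<^sub>1\<close> beyond
  \<open>2\<^sup>E\<close> contribute \<open>O(1)\<close> to the sum of reciprocals, while by Mertens all primes below
  \<open>2\<^sup>E\<close> contribute a factor \<open>O(E)\<close> to the Euler product. So the Euler product over \<open>Q\<^sub>k\<close> is at
  most \<open>C\<^sup>k\<close>, and a second application of the sieve bounds the number of \<open>n \<le> x\<close> composed of primes
  from \<open>Q\<^sub>k\<close> by \<open>O(C\<^sup>k x / log x)\<close>, which is \<open>o(x)\<close> for \<open>k \<le> c log log x\<close> with \<open>c\<close> small.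
\<close>

section \<open>Truncated Euler products\<close>

text \<open>A set \<open>D\<close> of primes stands for the squarefree number
  \<open>\<Prod>D\<close>. The sum is thus the part up to \<open>w\<close> of the expanded Euler
  product of \<open>1 + a r\<close> over \<open>R\<close>; with Selberg weights for \<open>a\<close>
  it is the denominator of the sieve bound.\<close>

definition truncsum :: "nat set \<Rightarrow> (nat \<Rightarrow> real) \<Rightarrow> real \<Rightarrow> real" where
  "truncsum R a w = (\<Sum>D | D \<subseteq> R \<and> real (\<Prod>D) \<le> w. \<Prod>r\<in>D. a r)"

lemma truncsum_empty: "truncsum {} a w = (if w \<ge> 1 then 1 else 0)"
proof -
  have "{D. D \<subseteq> {} \<and> real (\<Prod>D) \<le> w} = (if w \<ge> 1 then {{}} else {})"
    by auto
  thus ?thesis by (simp add: truncsum_def)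
qed

lemma truncsum_nonneg:
  assumes "\<And>r. r \<in> R \<Longrightarrow> a r \<ge> 0"
  shows   "truncsum R a w \<ge> 0"
  unfolding truncsum_def using assms by (intro sum_nonneg prod_nonneg) auto

lemma truncsum_mono:
  assumes "finite R" "\<And>r. r \<in> R \<Longrightarrow> a r \<ge> 0" "w \<le> w'"
  shows   "truncsum R a w \<le> truncsum R a w'"
  unfolding truncsum_def using assms by (intro sum_mono2 prod_nonneg) auto

text \<open>Subsets are split by whether they contain \<open>r\<close>; removing \<open>r\<close>
  divides the product by \<open>r\<close>. All inductions on \<open>R\<close> rest on this
  recursion.\<close>

lemma truncsum_insert:
  assumes "finite R" "r \<notin> R" "r > 0"
  shows   "truncsum (insert r R) a w = truncsum R a w + a r * truncsum R a (w / r)"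
proof -
  let ?A = "{D. D \<subseteq> R \<and> real (\<Prod>D) \<le> w}" and ?B = "{D. D \<subseteq> R \<and> real (\<Prod>D) \<le> w / r}"
  have fin: "finite D" if "D \<subseteq> R" for D
    using that assms(1) finite_subset by blast
  have prod: "real (\<Prod>(insert r D)) = r * real (\<Prod>D)" if "D \<subseteq> R" for D
    using that assms(2) fin[OF that] by (subst prod.insert) auto
  have "{D. D \<subseteq> insert r R \<and> real (\<Prod>D) \<le> w} = ?A \<union> insert r ` ?B"
  proof (intro equalityI subsetI)
    fix D assume D: "D \<in> {D. D \<subseteq> insert r R \<and> real (\<Prod>D) \<le> w}"
    show "D \<in> ?A \<union> insert r ` ?B"
    proof (cases "r \<in> D")
      case True
      define D' where "D' = D - {r}"
      have D': "D = insert r D'" "D' \<subseteq> R" using True D by (auto simp: D'_def)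
      with D prod[OF D'(2)] assms(3) have "D' \<in> ?B"
        by (auto simp: field_simps simp del: of_nat_prod)
      thus ?thesis using D' by auto
    qed (use D in auto)
  next
    fix D assume "D \<in> ?A \<union> insert r ` ?B"
    thus "D \<in> {D. D \<subseteq> insert r R \<and> real (\<Prod>D) \<le> w}"
      using prod assms(3) by (auto simp: field_simps simp del: of_nat_prod)
  qed
  hence "truncsum (insert r R) a w = (\<Sum>D\<in>?A \<union> insert r ` ?B. \<Prod>r\<in>D. a r)"
    by (simp add: truncsum_def)
  also have "\<dots> = truncsum R a w + (\<Sum>D\<in>insert r ` ?B. \<Prod>r\<in>D. a r)"
    unfolding truncsum_def using assms(1,2) by (intro sum.union_disjoint) auto
  also have "(\<Sum>D\<in>insert r ` ?B. \<Prod>r\<in>D. a r) = (\<Sum>D\<in>?B. \<Prod>r\<in>insert r D. a r)"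
    using assms(2) by (intro sum.reindex_cong[of "insert r"]) (auto simp: inj_on_def)
  also have "\<dots> = (\<Sum>D\<in>?B. a r * (\<Prod>r\<in>D. a r))"
    using assms(2) fin by (intro sum.cong prod.insert) auto
  also have "\<dots> = a r * truncsum R a (w / r)"
    by (simp add: truncsum_def sum_distrib_left)
  finally show ?thesis .
qed

lemma truncsum_ge_1:
  assumes "finite R" "\<And>r. r \<in> R \<Longrightarrow> a r \<ge> 0" "w \<ge> 1"
  shows   "truncsum R a w \<ge> 1"
proof -
  have "(\<Sum>D\<in>{{}}. \<Prod>r\<in>D. a r) \<le> truncsum R a w"
    unfolding truncsum_def using assms by (intro sum_mono2 prod_nonneg) auto
  thus ?thesis by simp
qed

text \<open>Each \<open>D\<close> splits into its parts outside and inside \<open>Q\<close>. The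
  first still has product at most \<open>w\<close>, and there \<open>g\<close> dominates
  \<open>1 / r\<close>; summing the second without truncation gives the Euler product. With Selberg
  weights for \<open>g\<close> this bounds the sieve denominator from below.\<close>

lemma truncsum_le_truncsum_times_prod:
  assumes "finite R" "\<And>r. r \<in> R \<Longrightarrow> r > 0" "\<And>r. r \<in> R \<Longrightarrow> g r \<ge> 0"
      and "\<And>r. r \<in> R \<Longrightarrow> r \<notin> Q \<Longrightarrow> g r \<ge> 1 / r"
  shows   "truncsum R (\<lambda>r. 1 / r) w \<le> truncsum R g w * (\<Prod>q\<in>R \<inter> Q. 1 + 1 / q)"
  using assms
proof (induction R arbitrary: w rule: finite_induct)
  case (insert r R)
  let ?A = "truncsum R (\<lambda>r. 1 / r)" and ?H = "truncsum R g"
  define P where "P = (\<Prod>q\<in>R \<inter> Q. 1 + 1 / real q)"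
  have P: "P \<ge> 0" unfolding P_def by (intro prod_nonneg) auto
  have IH: "?A w \<le> ?H w * P" for w
    unfolding P_def using insert.prems by (intro insert.IH) auto
  have r: "real r > 0" "g r \<ge> 0" using insert.prems by auto
  have H: "?H (w / r) \<ge> 0" "?H w \<ge> 0"
    using insert.prems by (auto intro!: truncsum_nonneg)
  have mono: "?H (w / r) \<le> ?H w" if "w \<ge> 0"
    using insert.prems insert.hyps that r
    by (intro truncsum_mono) (auto simp: field_simps mult_le_cancel_left1 Suc_le_eq)
  \<comment> \<open>For negative \<open>w\<close> the quotient \<open>w / r\<close> is not below
    \<open>w\<close>, so monotonicity does not apply; but then no product is at most
    \<open>w / r\<close>.\<close>
  have neg: "?H (w / r) = 0" if "w < 0"
  proof -
    have "w / r < 0" using that r by (simp add: divide_neg_pos)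
    hence "\<not> real (\<Prod>D) \<le> w / r" for D
      by (smt (verit) of_nat_0_le_iff)
    hence "{D. D \<subseteq> R \<and> real (\<Prod>D) \<le> w / r} = {}" by blast
    thus ?thesis unfolding truncsum_def by (simp only: sum.empty)
  qed
  have le: "?H (w / r) \<le> ?H w" using mono neg H by (cases "w \<ge> 0") auto
  have "truncsum (insert r R) (\<lambda>r. 1 / r) w \<le> (?H w + 1 / r * ?H (w / r)) * P"
    using insert.hyps insert.prems r IH[of w] mult_left_mono[OF IH[of "w / r"], of "1 / r"]
    by (simp add: truncsum_insert distrib_right)
  also have "\<dots> \<le> truncsum (insert r R) g w * (\<Prod>q\<in>insert r R \<inter> Q. 1 + 1 / q)"
  proof (cases "r \<in> Q")
    case True
    have "?H w + 1 / r * ?H (w / r) \<le> (?H w + g r * ?H (w / r)) * (1 + 1 / r)"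
      using r H le by (simp add: field_simps add_increasing2 add_mono)
    from mult_right_mono[OF this P] True show ?thesis
      using insert.hyps r by (simp add: truncsum_insert P_def mult_ac Int_insert_left)
  next
    case False
    have "?H w + 1 / r * ?H (w / r) \<le> ?H w + g r * ?H (w / r)"
      using insert.prems False H by (intro add_mono mult_right_mono) auto
    from mult_right_mono[OF this P] False show ?thesis
      using insert.hyps r by (simp add: truncsum_insert P_def mult_ac Int_insert_left)
  qed
  finally show ?case .
qed (simp add: truncsum_empty)

text \<open>A pair of sets from the two sums has a union with product at most \<open>v * w\<close>,
  and an element \<open>r\<close> of the union comes from the first set, the second or both, with
  total weight 2/r + 1/r^2. Outside \<open>Q\<close> this is dominated by \<open>g r\<close>; inside
  \<open>Q\<close>, \<open>g r \<ge> 1 / r\<close> together with the Euler factor yields (1 +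
  1/r)^2.\<close>

lemma truncsum_mult_le_truncsum_times_prod:
  assumes "finite R" "\<And>r. r \<in> R \<Longrightarrow> r > 0" "\<And>r. r \<in> R \<Longrightarrow> g r \<ge> 1 / r"
      and "\<And>r. r \<in> R \<Longrightarrow> r \<notin> Q \<Longrightarrow> g r \<ge> 2 / r + 1 / r ^ 2"
      and "v \<ge> 0" "w \<ge> 0"
  shows   "truncsum R (\<lambda>r. 1 / r) v * truncsum R (\<lambda>r. 1 / r) w
             \<le> truncsum R g (v * w) * (\<Prod>q\<in>R \<inter> Q. 1 + 1 / q)"
  using assms
proof (induction R arbitrary: v w rule: finite_induct)
  case empty
  thus ?case using mult_mono[of 1 v 1 w] by (auto simp: truncsum_empty)
next
  case (insert r R)
  let ?A = "truncsum R (\<lambda>r. 1 / r)" and ?H = "truncsum R g"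
  define P where "P = (\<Prod>q\<in>R \<inter> Q. 1 + 1 / real q)"
  define t where "t = 1 / real r"
  have P: "P \<ge> 0" unfolding P_def by (intro prod_nonneg) auto
  have IH: "?A v * ?A w \<le> ?H (v * w) * P" if "v \<ge> 0" "w \<ge> 0" for v w
    unfolding P_def using insert.prems that by (intro insert.IH) auto
  have r: "real r \<ge> 1" "t > 0" "t \<le> g r" using insert.prems by (auto simp: t_def Suc_le_eq)
  have g: "g s \<ge> 0" if "s \<in> R" for s
    using insert.prems(2)[of s] that by (auto intro: order_trans[rotated])
  have A: "?A u \<ge> 0" for u by (auto intro!: truncsum_nonneg)
  have H: "?H u \<ge> 0" for u using g by (auto intro!: truncsum_nonneg)
  define x where "x = v * w"
  have x: "x \<ge> 0" using insert.prems by (simp add: x_def)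
  have le: "?H (u / r) \<le> ?H u" if "u \<ge> 0" for u
    using insert.hyps that r g
    by (intro truncsum_mono) (auto simp: field_simps mult_le_cancel_left1)
  have le1: "?H (x / r) \<le> ?H x" and le2: "?H (x / r / r) \<le> ?H (x / r)"
    using x r by (intro le; simp)+
  have "truncsum (insert r R) (\<lambda>r. 1 / r) v * truncsum (insert r R) (\<lambda>r. 1 / r) w
          = ?A v * ?A w + t * (?A (v / r) * ?A w) + t * (?A v * ?A (w / r))
            + t\<^sup>2 * (?A (v / r) * ?A (w / r))"
    using insert.hyps insert.prems r
    by (simp add: truncsum_insert t_def algebra_simps power2_eq_square)
  also have "\<dots> \<le> ?H x * P + t * (?H (x / r) * P) + t * (?H (x / r) * P) + t\<^sup>2 * (?H (x / r / r) * P)"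
    using insert.prems r IH[of v w] IH[of "v / r" w] IH[of v "w / r"] IH[of "v / r" "w / r"]
    by (intro add_mono mult_left_mono) (auto simp: x_def)
  also have "\<dots> = (?H x + 2 * t * ?H (x / r) + t\<^sup>2 * ?H (x / r / r)) * P"
    by (simp add: algebra_simps)
  also have "\<dots> \<le> truncsum (insert r R) g x * (\<Prod>q\<in>insert r R \<inter> Q. 1 + 1 / q)"
  proof (cases "r \<in> Q")
    case True
    \<comment> \<open>One of the two copies of \<open>t * ?H (x / r)\<close> is enlarged to
      \<open>t * ?H x\<close>, which lets the Euler factor \<open>1 + t\<close> be split
      off.\<close>
    have "?H x + 2 * t * ?H (x / r) + t\<^sup>2 * ?H (x / r / r)
            \<le> ?H x + (t * ?H x + t * ?H (x / r)) + t\<^sup>2 * ?H (x / r)"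
      using r le1 le2 by (intro add_mono mult_left_mono) (auto simp: algebra_simps)
    also have "\<dots> = (?H x + t * ?H (x / r)) * (1 + t)"
      by (simp add: algebra_simps power2_eq_square)
    also have "\<dots> \<le> (?H x + g r * ?H (x / r)) * (1 + t)"
      using r H by (intro mult_right_mono add_mono) auto
    finally have "?H x + 2 * t * ?H (x / r) + t\<^sup>2 * ?H (x / r / r)
            \<le> (?H x + g r * ?H (x / r)) * (1 + t)" .
    from mult_right_mono[OF this P] True show ?thesis
      using insert.hyps insert.prems by (simp add: truncsum_insert P_def t_def mult_ac Int_insert_left)
  next
    case False
    have "?H x + 2 * t * ?H (x / r) + t\<^sup>2 * ?H (x / r / r)
            \<le> ?H x + 2 * t * ?H (x / r) + t\<^sup>2 * ?H (x / r)"
      using r le2 by (intro add_mono mult_left_mono) auto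
    also have "\<dots> = ?H x + (2 / r + 1 / r ^ 2) * ?H (x / r)"
      by (simp add: t_def algebra_simps power_divide)
    also have "\<dots> \<le> ?H x + g r * ?H (x / r)"
      using insert.prems False H by (intro add_mono mult_right_mono) auto
    finally have "?H x + 2 * t * ?H (x / r) + t\<^sup>2 * ?H (x / r / r) \<le> ?H x + g r * ?H (x / r)" .
    from mult_right_mono[OF this P] False show ?thesis
      using insert.hyps insert.prems by (simp add: truncsum_insert P_def mult_ac Int_insert_left)
  qed
  finally show ?case by (simp add: x_def)
qed

section \<open>The sieve\<close>

text \<open>By the Chinese remainder theorem, the residues modulo the primes in \<open>R\<close>
  vary independently as \<open>m\<close> runs through a period. One prime is peeled off at a
  time.\<close>

lemma sum_prod_mod_coprime:
  fixes f :: "nat \<Rightarrow> nat \<Rightarrow> real"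
  assumes "finite R" "\<And>r. r \<in> R \<Longrightarrow> prime r"
  shows   "(\<Sum>m<\<Prod>R. \<Prod>r\<in>R. f r (m mod r)) = (\<Prod>r\<in>R. \<Sum>a<r. f r a)"
  using assms
proof (induction R rule: finite_induct)
  case (insert r R)
  define P where "P = \<Prod>R"
  define F where "F m = (\<Prod>r\<in>R. f r (m mod r))" for m
  have pos: "r > 0" "P > 0"
    using insert.prems prime_gt_0_nat by (auto simp: P_def intro!: prod_pos)
  have cop: "coprime r P"
    unfolding P_def using insert.hyps insert.prems
    by (intro prod_coprime_right primes_coprime) auto
  have F_mod: "F (m mod P) = F m" for m
    unfolding F_def P_def using insert.hyps
    by (intro prod.cong refl) (simp add: mod_mod_cancel dvd_prodI[of R _ "\<lambda>r. r"])
  have inj: "inj_on (\<lambda>m. (m mod r, m mod P)) {..<r * P}"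
  proof (rule inj_onI)
    fix a b assume "a \<in> {..<r * P}" "b \<in> {..<r * P}" "(a mod r, a mod P) = (b mod r, b mod P)"
    thus "a = b"
      using cong_less_modulus_unique_nat[of a b "r * P"] coprime_cong_mult_nat[of a b r P] cop
      by (auto simp: cong_def)
  qed
  have "(\<lambda>m. (m mod r, m mod P)) ` {..<r * P} = {..<r} \<times> {..<P}"
    using inj pos by (intro card_subset_eq) (auto simp: card_image card_cartesian_product)
  with inj have bij: "bij_betw (\<lambda>m. (m mod r, m mod P)) {..<r * P} ({..<r} \<times> {..<P})"
    by (simp add: bij_betw_def)
  have "(\<Sum>m<\<Prod>(insert r R). \<Prod>s\<in>insert r R. f s (m mod s)) = (\<Sum>m<r * P. f r (m mod r) * F (m mod P))"
    using insert.hyps unfolding F_mod by (simp add: P_def F_def)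
  also have "\<dots> = (\<Sum>(a, b)\<in>{..<r} \<times> {..<P}. f r a * F b)"
    using sum.reindex_bij_betw[OF bij, of "\<lambda>(a, b). f r a * F b"] by simp
  also have "\<dots> = (\<Sum>a<r. f r a) * (\<Sum>b<P. F b)"
    by (simp add: sum_product sum.cartesian_product)
  also have "\<dots> = (\<Prod>s\<in>insert r R. \<Sum>a<s. f s a)"
    using insert by (simp add: P_def F_def)
  finally show ?case .
qed auto

text \<open>There are \<open>x div P\<close> full periods and a rest of fewer than \<open>P\<close>
  terms, each at most 1. Nonnegativity of the sum over a period allows \<open>x div P\<close> to be
  replaced by x/P.\<close>

lemma sum_periodic_le:
  fixes u :: "nat \<Rightarrow> real"
  assumes "P > 0" "\<And>m. u (m mod P) = u m" "\<And>m. \<bar>u m\<bar> \<le> 1" "(\<Sum>m<P. u m) \<ge> 0"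
  shows   "(\<Sum>m<x. u m) \<le> real x / real P * (\<Sum>m<P. u m) + real P"
proof -
  define q where "q = x div P"
  have x: "q * P \<le> x" "x < q * P + P"
    using assms(1) div_mult_mod_eq[of x P] mod_less_divisor[of P x] unfolding q_def by linarith+
  have "(\<Sum>m\<in>{i * P..<i * P + P}. u m) = (\<Sum>m<P. u m)" for i
  proof -
    have "(\<Sum>m\<in>{i * P..<i * P + P}. u m) = (\<Sum>m<P. u (m + i * P))"
      by (rule sum.reindex_bij_witness[of _ "\<lambda>m. m + i * P" "\<lambda>m. m - i * P"]) auto
    also have "\<dots> = (\<Sum>m<P. u m)"
      by (intro sum.cong refl) (metis assms(2) mod_mult_self1 mult.commute)
    finally show ?thesis .
  qed
  hence "(\<Sum>m<q * P. u m) = real q * (\<Sum>m<P. u m)"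
    by (simp flip: sum.nat_group)
  moreover have "(\<Sum>m<x. u m) = (\<Sum>m<q * P. u m) + (\<Sum>m=q * P..<x. u m)"
    using x by (simp add: lessThan_atLeast0 sum.atLeastLessThan_concat)
  moreover have "(\<Sum>m=q * P..<x. u m) \<le> (\<Sum>m=q * P..<x. 1)"
    using assms(3) by (intro sum_mono) (auto dest: abs_le_D1)
  moreover have "real q * (\<Sum>m<P. u m) \<le> real x / real P * (\<Sum>m<P. u m)"
    using assms(1,4) x by (intro mult_right_mono) (auto simp: field_simps simp flip: of_nat_mult)
  moreover have "real x \<le> real q * real P + real P"
    using x by (simp flip: of_nat_mult of_nat_add)
  ultimately show ?thesis using x by simp
qed

text \<open>Unique factorization: the set is recovered as the prime factors of its product.\<close>

lemma inj_on_Prod_primes: "inj_on (\<lambda>D. \<Prod>D) {D. finite D \<and> (\<forall>r\<in>D. prime (r :: nat))}"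
proof (rule inj_onI)
  fix D E :: "nat set"
  assume "D \<in> {D. finite D \<and> (\<forall>r\<in>D. prime r)}" "E \<in> {D. finite D \<and> (\<forall>r\<in>D. prime r)}" and eq: "\<Prod>D = \<Prod>E"
  moreover have "prime_factors (\<Prod>D) = D" if "finite D" "\<forall>r\<in>D. prime r" for D :: "nat set"
    using that by (subst prime_factors_prod) (auto simp: prime_prime_factors dest: prime_gt_0_nat)
  ultimately show "D = E" by (metis (no_types, lifting) mem_Collect_eq)
qed

text \<open>The value off \<open>W\<close> is chosen to balance the -1 on \<open>W\<close>. These
  are the local factors at \<open>r\<close> in the correlations of the sieve: 0 for a prime in only
  one of the two sets, \<open>r\<close> times the Selberg weight for a prime in both.\<close>

lemma sieve_weight_sums:
  assumes "prime r" "W \<subseteq> {..<r}" "card W < r"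
  shows   "(\<Sum>a<r. if a \<in> W then -1 else real (card W) / (real r - real (card W))) = 0" (is "?S = 0")
    and   "(\<Sum>a<r. (if a \<in> W then -1 else real (card W) / (real r - real (card W))) ^ 2)
             = real r * (real (card W) / (real r - real (card W)))" (is "?T = _")
proof -
  define w where "w = real (card W)"
  have w: "w < real r" using assms(3) by (simp add: w_def)
  have fin: "finite W" using assms(2) finite_subset by blast
  have split: "(\<Sum>a<r. if a \<in> W then u else v) = w * u + (r - w) * v" for u v :: real
  proof -
    have "(\<Sum>a<r. if a \<in> W then u else v) = (\<Sum>a\<in>W. u) + (\<Sum>a\<in>{..<r} - W. v)"
      using assms(2) by (subst sum.If_cases) (auto simp: Int_absorb1 Diff_eq)
    also have "card ({..<r} - W) = r - card W"
      using assms(2) fin by (subst card_Diff_subset) auto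
    hence "(\<Sum>a\<in>{..<r} - W. v) = (r - w) * v"
      using assms(3) by (simp add: w_def of_nat_diff)
    finally show ?thesis by (simp add: w_def)
  qed
  show "?S = 0" using w unfolding split by (simp add: w_def)
  have "?T = (\<Sum>a<r. if a \<in> W then 1 else (w / (r - w)) ^ 2)"
    by (intro sum.cong) (auto simp: w_def)
  also have "\<dots> = r * (w / (r - w))"
    unfolding split using w by (simp add: divide_simps) (simp add: algebra_simps power2_eq_square)
  finally show "?T = real r * (real (card W) / (real r - real (card W)))" by (simp add: w_def)
qed

text \<open>
  On \<open>A\<close> the function \<open>\<Sum>D. H D\<close> is constantly \<open>G = truncsum R g z\<close>, so \<open>card A\<close> times \<open>G\<^sup>2\<close> is at most
  its second moment. The weights \<open>h r\<close> have mean zero over a period, so by the Chinese remainder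
  theorem the \<open>H D\<close> are orthogonal over full periods.
\<close>

theorem selberg_sieve:
  fixes W :: "nat \<Rightarrow> nat set" and z :: real
  defines "g \<equiv> \<lambda>r. real (card (W r)) / (real r - real (card (W r)))"
  assumes R: "finite R" "\<And>r. r \<in> R \<Longrightarrow> prime r"
      and W: "\<And>r. r \<in> R \<Longrightarrow> W r \<subseteq> {..<r}" "\<And>r. r \<in> R \<Longrightarrow> 2 * card (W r) \<le> r"
      and A: "A \<subseteq> {..<x}" "\<And>m r. m \<in> A \<Longrightarrow> r \<in> R \<Longrightarrow> m mod r \<notin> W r"
      and z: "z \<ge> 1"
  shows   "real (card A) \<le> real x / truncsum R g z + z ^ 4 / truncsum R g z ^ 2"
proof -
  define G where "G = truncsum R g z"
  define h where "h r a = (if a \<in> W r then -1 else g r)" for r a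
  define T where "T = {D. D \<subseteq> R \<and> real (\<Prod>D) \<le> z}"
  define H where "H D m = (\<Prod>r\<in>D. h r (m mod r))" for D m
  have g: "g r \<ge> 0" "g r \<le> 1" if "r \<in> R" for r
    using W(2)[OF that] R(2)[OF that] prime_gt_0_nat[of r] unfolding g_def by (auto simp: field_simps)
  have W': "card (W r) < r" if "r \<in> R" for r
    using W(2)[OF that] R(2)[OF that] prime_gt_0_nat[of r] by simp
  have h: "\<bar>h r a\<bar> \<le> 1" if "r \<in> R" for r a
    using g[OF that] by (auto simp: h_def)
  have T: "D \<subseteq> R" "finite D" "real (\<Prod>D) \<le> z" "\<Prod>D > 0" "\<And>r. r \<in> D \<Longrightarrow> prime r" if "D \<in> T" for D
    using that R finite_subset[of D R] prime_gt_0_nat by (auto simp: T_def intro!: prod_pos)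
  have finT: "finite T" using R by (simp add: T_def)
  have G1: "G \<ge> 1" unfolding G_def using R g z by (intro truncsum_ge_1) auto

  have H_abs: "\<bar>H D m\<bar> \<le> 1" if "D \<in> T" for D m
    unfolding H_def abs_prod using T(1)[OF that] h by (intro prod_le_1) auto
  have H_mod: "H D (m mod P) = H D m" if "D \<in> T" "\<Prod>D dvd P" for D m P
    unfolding H_def
  proof (intro prod.cong refl)
    fix r assume "r \<in> D"
    hence "r dvd \<Prod>D" using T(2)[OF that(1)] by (intro dvd_prodI) auto
    thus "h r (m mod P mod r) = h r (m mod r)"
      using that(2) by (simp add: mod_mod_cancel dvd_trans)
  qed

  \<comment> \<open>\<open>H D * H E\<close> has period \<open>\<Prod>(D \<union> E)\<close>, which
    is at most z^2, and this bounds the error from an incomplete period. If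
    \<open>D \<noteq> E\<close>, a prime in just one of the sets contributes the mean of
    \<open>h r\<close>, so the sum over a period vanishes.\<close>
  have corr: "(\<Sum>m<x. H D m * H E m) \<le> (if D = E then real x * (\<Prod>r\<in>D. g r) else 0) + z ^ 2"
    if "D \<in> T" "E \<in> T" for D E
  proof -
    define P where "P = \<Prod>(D \<union> E)"
    define f where "f r a = (if r \<in> D then h r a else 1) * (if r \<in> E then h r a else 1)" for r a
    have fin: "finite (D \<union> E)" "\<And>r. r \<in> D \<union> E \<Longrightarrow> prime r"
      using T that by auto
    have P: "P > 0" unfolding P_def using fin prime_gt_0_nat by (intro prod_pos) auto
    have "real P * real (\<Prod>(D \<inter> E)) = real (\<Prod>D) * real (\<Prod>E)"
      unfolding P_def using T that by (simp flip: of_nat_mult add: prod.union_inter)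
    also have "\<dots> \<le> z * z" using T that z by (intro mult_mono) (auto intro!: prod_nonneg)
    finally have "real P * real (\<Prod>(D \<inter> E)) \<le> z ^ 2" by (simp add: power2_eq_square)
    moreover have "\<Prod>(D \<inter> E) \<ge> 1"
      using fin prime_gt_0_nat by (intro prod_ge_1) (auto simp: Suc_le_eq)
    hence "real P * 1 \<le> real P * real (\<Prod>(D \<inter> E))"
      by (intro mult_left_mono) linarith+
    ultimately have Pz: "real P \<le> z ^ 2" by simp
    have dvd: "\<Prod>D dvd P" "\<Prod>E dvd P"
      unfolding P_def using fin by (auto intro!: prod_dvd_prod_subset)
    have HH: "H D m * H E m = (\<Prod>r\<in>D \<union> E. f r (m mod r))" for m
    proof -
      have "H D m = (\<Prod>r\<in>D \<union> E. if r \<in> D then h r (m mod r) else 1)"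
           "H E m = (\<Prod>r\<in>D \<union> E. if r \<in> E then h r (m mod r) else 1)"
        unfolding H_def using fin by (auto intro!: prod.mono_neutral_cong_left)
      thus ?thesis by (simp add: f_def prod.distrib)
    qed
    have "(\<Sum>m<P. H D m * H E m) = (\<Prod>r\<in>D \<union> E. \<Sum>a<r. f r a)"
      unfolding HH P_def using fin by (intro sum_prod_mod_coprime) auto
    also have "\<dots> = (if D = E then real P * (\<Prod>r\<in>D. g r) else 0)"
    proof (cases "D = E")
      case True
      have "(\<Prod>r\<in>D \<union> E. \<Sum>a<r. f r a) = (\<Prod>r\<in>D. real r * g r)"
      proof (intro prod.cong)
        fix r assume "r \<in> D"
        with True T(1)[OF that(1)] have "r \<in> R" by auto
        with \<open>r \<in> D\<close> True sieve_weight_sums(2)[OF R(2) W(1) W', of r]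
        show "(\<Sum>a<r. f r a) = real r * g r"
          unfolding f_def h_def g_def by (simp add: power2_eq_square)
      qed (use True in auto)
      thus ?thesis using True by (simp add: prod.distrib P_def)
    next
      case False
      then obtain r where r: "r \<in> D \<union> E" "r \<notin> D \<inter> E" by blast
      hence "r \<in> R" using T(1) that by blast
      have "(\<Sum>a<r. f r a) = (\<Sum>a<r. h r a)"
        using r by (intro sum.cong) (auto simp: f_def)
      also have "\<dots> = 0"
        using sieve_weight_sums(1)[OF R(2) W(1) W', OF \<open>r \<in> R\<close> \<open>r \<in> R\<close> \<open>r \<in> R\<close>]
        unfolding h_def g_def by simp
      finally show ?thesis using False r(1) fin(1) by auto
    qed
    finally have S: "(\<Sum>m<P. H D m * H E m) = (if D = E then real P * (\<Prod>r\<in>D. g r) else 0)" .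
    have "(\<Sum>m<x. H D m * H E m) \<le> real x / real P * (\<Sum>m<P. H D m * H E m) + real P"
    proof (rule sum_periodic_le)
      show "\<bar>H D m * H E m\<bar> \<le> 1" for m
        using H_abs that unfolding abs_mult by (intro mult_le_one) auto
      show "(\<Sum>m<P. H D m * H E m) \<ge> 0"
        unfolding S using g T(1)[OF that(1)] by (auto intro!: mult_nonneg_nonneg prod_nonneg)
    qed (use P H_mod that dvd in auto)
    also have "real x / real P * (\<Sum>m<P. H D m * H E m) = (if D = E then real x * (\<Prod>r\<in>D. g r) else 0)"
      unfolding S using P by simp
    finally show ?thesis using Pz by simp
  qed

  \<comment> \<open>Distinct members of \<open>T\<close> have distinct products in [1, z]; so there
    are at most z^2 pairs, and the errors z^2 add up to at most z^4.\<close>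
  have "card T \<le> card {1..nat \<lfloor>z\<rfloor>}"
  proof (rule card_inj_on_le)
    show "inj_on (\<lambda>D. \<Prod>D) T"
      using inj_on_Prod_primes by (rule inj_on_subset) (use T in auto)
    show "(\<lambda>D. \<Prod>D) ` T \<subseteq> {1..nat \<lfloor>z\<rfloor>}"
      using T(3,4) by (force simp: le_nat_floor Suc_le_eq simp del: of_nat_prod)
  qed auto
  hence cardT: "real (card T) \<le> z" using z by simp linarith

  have "real (card A) * G ^ 2 = (\<Sum>m\<in>A. G ^ 2)" by simp
  also have "\<dots> = (\<Sum>m\<in>A. (\<Sum>D\<in>T. H D m) ^ 2)"
  proof (intro sum.cong refl arg_cong[where f = "\<lambda>x. x ^ 2"])
    fix m assume "m \<in> A"
    have "H D m = (\<Prod>r\<in>D. g r)" if "D \<in> T" for D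
      unfolding H_def h_def using A(2)[OF \<open>m \<in> A\<close>] T(1)[OF that] by (intro prod.cong) auto
    thus "G = (\<Sum>D\<in>T. H D m)" by (simp add: G_def truncsum_def T_def)
  qed
  also have "\<dots> \<le> (\<Sum>m<x. (\<Sum>D\<in>T. H D m) ^ 2)"
    using A(1) by (intro sum_mono2) auto
  also have "\<dots> = (\<Sum>m<x. \<Sum>D\<in>T. \<Sum>E\<in>T. H D m * H E m)"
    by (simp add: power2_eq_square sum_product)
  also have "\<dots> = (\<Sum>D\<in>T. \<Sum>E\<in>T. \<Sum>m<x. H D m * H E m)"
    by (subst sum.swap) (intro sum.cong refl sum.swap)
  also have "\<dots> \<le> (\<Sum>D\<in>T. \<Sum>E\<in>T. (if D = E then real x * (\<Prod>r\<in>D. g r) else 0) + z ^ 2)"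
    by (intro sum_mono corr)
  also have "\<dots> = real x * G + (real (card T)) ^ 2 * z ^ 2"
    using finT by (simp add: sum.distrib sum_distrib_left power2_eq_square G_def truncsum_def T_def)
  also have "\<dots> \<le> real x * G + z ^ 2 * z ^ 2"
    using cardT by (intro add_left_mono mult_right_mono power_mono) auto
  finally have "real (card A) * G ^ 2 \<le> real x * G + z ^ 4" by (simp flip: power_add)
  hence "real (card A) \<le> (real x * G + z ^ 4) / G ^ 2"
    using G1 by (simp add: pos_le_divide_eq)
  also have "\<dots> = real x / G + z ^ 4 / G ^ 2"
    using G1 by (simp add: field_simps power2_eq_square)
  finally show ?thesis by (simp add: G_def)
qed

section \<open>Estimates of Mertens type\<close>

abbreviation primes_upto :: "nat \<Rightarrow> nat set" where
  "primes_upto n \<equiv> {p. prime p \<and> p \<le> n}"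

section \<open>Lower bound for the truncated Euler product over the primes\<close>

lemma finite_primes_upto: "finite (primes_upto n)"
  by (rule finite_subset[of _ "{..n}"]) auto

text \<open>\<open>harm n - ln n\<close> decreases from its value 1 at n = 1.\<close>

lemma harm_le_ln: "n > 0 \<Longrightarrow> harm n \<le> 1 + ln (real n)"
  using decseqD[OF decseq_harm_diff_ln, of 0 "n - 1"]
  by (simp add: harm_Suc harm_expand(1))

lemma sum_inverse_squares_le: "(\<Sum>k=1..n. 1 / real k ^ 2) \<le> 2"
proof -
  \<comment> \<open>The induction carries the sharper bound 2 - 1/n, which matches the telescoping
    estimate 1/(n+1)^2 \<le> 1/n - 1/(n+1).\<close>
  have "n > 0 \<Longrightarrow> (\<Sum>k=1..n. 1 / real k ^ 2) \<le> 2 - 1 / n"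
  proof (induction n)
    case (Suc n)
    show ?case
    proof (cases "n = 0")
      case False
      have "1 / real (Suc n) ^ 2 \<le> 1 / (real n * real (Suc n))"
        using False by (intro frac_le) (auto simp: power2_eq_square)
      also have "\<dots> = 1 / n - 1 / real (Suc n)" using False by (simp add: field_simps)
      finally have "1 / real (Suc n) ^ 2 \<le> 1 / n - 1 / real (Suc n)" .
      with Suc False show ?thesis by simp
    qed auto
  qed auto
  thus ?thesis by (cases "n = 0") (auto intro: order_trans)
qed

lemma prod_prime_factors_squarefree:
  assumes "squarefree (n :: nat)"
  shows   "\<Prod>(prime_factors n) = n"
proof -
  have n: "n \<noteq> 0" using assms not_squarefree_0 by metis
  have "(\<Prod>p\<in>prime_factors n. p) = (\<Prod>p\<in>prime_factors n. p ^ multiplicity p n)"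
    using assms n
    by (intro prod.cong refl)
       (auto simp: squarefree_factorial_semiring' prime_factors_multiplicity dest!: bspec)
  also have "\<dots> = n" using n by (subst prod_prime_factors) auto
  finally show ?thesis .
qed

text \<open>Every \<open>m \<le> n\<close> is a squarefree number times a square, both parts being
  at most \<open>n\<close>. Hence the harmonic sum, which is at least \<open>ln n\<close>, is at
  most the sum of 1/d over squarefree \<open>d \<le> n\<close> times the sum of 1/k^2, and the
  latter is at most 2.\<close>

lemma ln_le_truncsum_primes:
  assumes "n > 0"
  shows   "ln (real n) / 2 \<le> truncsum (primes_upto n) (\<lambda>p. 1 / p) n"
proof -
  define T where "T = {D. D \<subseteq> primes_upto n \<and> real (\<Prod>D) \<le> real n}"
  define F where "F = (\<lambda>m :: nat. (prime_factors (squarefree_part m), square_part m))"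
  define f where "f = (\<lambda>(D, k). (\<Prod>p\<in>D. 1 / real p) * (1 / real k ^ 2))"
  have T: "truncsum (primes_upto n) (\<lambda>p. 1 / p) n = (\<Sum>D\<in>T. \<Prod>p\<in>D. 1 / real p)"
    by (simp add: truncsum_def T_def)
  have finT: "finite T" unfolding T_def using finite_primes_upto by auto
  have dec: "m = \<Prod>(fst (F m)) * snd (F m) ^ 2" for m :: nat
    unfolding F_def using squarefree_decompose[of m]
    by (simp add: prod_prime_factors_squarefree)
  have "ln (real n) \<le> ln (real n + 1)" using assms by simp
  also have "\<dots> \<le> harm n" by (rule ln_le_harm)
  also have "harm n = (\<Sum>m=1..n. f (F m))"
    unfolding harm_def
  proof (intro sum.cong refl)
    fix m assume "m \<in> {1..n}"
    have "inverse (real m) = 1 / (real (\<Prod>(fst (F m))) * real (snd (F m)) ^ 2)"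
      by (subst dec) (simp add: divide_simps)
    thus "inverse (real m) = f (F m)"
      by (simp add: f_def case_prod_unfold prod_dividef)
  qed
  also have "\<dots> = (\<Sum>x\<in>F ` {1..n}. f x)"
  proof (rule sum.reindex_cong[symmetric])
    show "inj_on F {1..n}" using dec by (metis inj_onI)
  qed auto
  also have "\<dots> \<le> (\<Sum>x\<in>T \<times> {1..n}. f x)"
  proof (rule sum_mono2)
    show "F ` {1..n} \<subseteq> T \<times> {1..n}"
    proof (rule image_subsetI)
      fix m assume m: "m \<in> {1..n}"
      hence nz: "\<Prod>(fst (F m)) \<noteq> 0" "snd (F m) \<noteq> 0" using dec[of m] by (metis atLeastAtMost_iff mult_eq_0_iff not_one_le_zero power_eq_0_iff zero_power2)+
      have "\<Prod>(fst (F m)) dvd m" "snd (F m) dvd m"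
        using dec[of m] by (metis dvd_triv_left, metis dvd_mult dvd_triv_left power2_eq_square)
      hence le: "\<Prod>(fst (F m)) \<le> m" "snd (F m) \<le> m" using m by (auto dest: dvd_imp_le)
      have "fst (F m) \<subseteq> primes_upto n"
      proof
        fix p assume "p \<in> fst (F m)"
        hence "prime p" "p dvd squarefree_part m" by (auto simp: F_def)
        hence "p dvd m" using squarefree_decompose[of m] by (metis dvd_mult2)
        thus "p \<in> primes_upto n" using \<open>prime p\<close> m by (auto dest: dvd_imp_le)
      qed
      moreover have "real (\<Prod>(fst (F m))) \<le> real n" using le m by (simp del: of_nat_prod)
      ultimately show "F m \<in> T \<times> {1..n}"
        using nz le m by (auto simp: T_def mem_Times_iff Suc_le_eq simp del: of_nat_prod)
    qed
  qed (use finT in \<open>auto simp: f_def intro!: divide_nonneg_nonneg prod_nonneg\<close>)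
  also have "\<dots> = (\<Sum>D\<in>T. \<Prod>p\<in>D. 1 / real p) * (\<Sum>k=1..n. 1 / real k ^ 2)"
    by (simp add: f_def sum_product sum.cartesian_product)
  also have "\<dots> \<le> (\<Sum>D\<in>T. \<Prod>p\<in>D. 1 / real p) * 2"
    by (intro mult_left_mono sum_inverse_squares_le sum_nonneg prod_nonneg) auto
  finally show ?thesis unfolding T by simp
qed

lemma prod_dvd_coprime:
  fixes f :: "'a \<Rightarrow> nat"
  assumes "finite A" "\<And>x. x \<in> A \<Longrightarrow> f x dvd n"
      and "\<And>x y. x \<in> A \<Longrightarrow> y \<in> A \<Longrightarrow> x \<noteq> y \<Longrightarrow> coprime (f x) (f y)"
  shows   "prod f A dvd n"
  using assms
proof (induction A rule: finite_induct)
  case (insert x A)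
  have "coprime (f x) (prod f A)" using insert by (intro prod_coprime_right) auto
  thus ?case using insert by (auto intro!: divides_mult)
qed auto

text \<open>Compare \<open>n!\<close> with its divisor \<open>\<Prod>p\<le>n. p\<^sup>\<lfloor>\<^sup>n\<^sup>/\<^sup>p\<^sup>\<rfloor>\<close>.\<close>

lemma sum_ln_prime_over_prime_le:
  assumes "n > 0"
  shows   "(\<Sum>p\<in>primes_upto n. ln p / p) \<le> 2 * ln n"
proof -
  \<comment> \<open>The multiples p, 2p, ... up to \<open>n\<close> are \<open>n div p\<close>
    distinct factors of the factorial.\<close>
  have dvd: "p ^ (n div p) dvd fact n" if "p > 0" for p
  proof -
    have "(\<Prod>i\<in>{1..n div p}. p * i) = (\<Prod>m\<in>(\<lambda>i. p * i) ` {1..n div p}. m)"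
      using that by (intro prod.reindex_cong[symmetric, of "\<lambda>i. p * i"]) (auto simp: inj_on_def)
    also have "\<dots> dvd (\<Prod>m\<in>{1..n}. m)"
      using that by (intro prod_dvd_prod_subset)
        (auto simp: less_eq_div_iff_mult_less_eq mult.commute Suc_le_eq)
    finally show ?thesis
      by (simp add: prod.distrib fact_prod dvd_mult_left)
  qed
  have "(\<Prod>p\<in>primes_upto n. p ^ (n div p)) dvd fact n"
    using finite_primes_upto[of n]
    by (intro prod_dvd_coprime dvd) (auto simp: prime_gt_0_nat primes_coprime)
  hence "(\<Prod>p\<in>primes_upto n. p ^ (n div p)) \<le> fact n"
    by (rule dvd_imp_le) auto
  also have "\<dots> \<le> n ^ n" using fact_le_power[of n, where ?'a = nat] by simp
  finally have "real (\<Prod>p\<in>primes_upto n. p ^ (n div p)) \<le> real (n ^ n)" by (rule of_nat_mono)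
  hence "ln (real (\<Prod>p\<in>primes_upto n. p ^ (n div p))) \<le> ln (real (n ^ n))"
    using assms prime_gt_0_nat by (subst ln_le_cancel_iff) (auto intro!: prod_pos)
  also have "ln (real (n ^ n)) = n * ln n" using assms by (simp add: ln_realpow)
  also have "ln (real (\<Prod>p\<in>primes_upto n. p ^ (n div p))) = (\<Sum>p\<in>primes_upto n. real (n div p) * ln p)"
    unfolding of_nat_prod using prime_gt_0_nat
    by (subst ln_prod) (auto simp: finite_primes_upto ln_realpow)
  finally have *: "(\<Sum>p\<in>primes_upto n. real (n div p) * ln p) \<le> n * ln n" .
  have "n / 2 * (\<Sum>p\<in>primes_upto n. ln p / p) = (\<Sum>p\<in>primes_upto n. n / (2 * p) * ln p)"
    by (simp add: sum_distrib_left mult_ac)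
  \<comment> \<open>Since \<open>p \<le> n\<close>, the quotient is at least 1, so rounding down
    loses at most a factor 2.\<close>
  also have "\<dots> \<le> (\<Sum>p\<in>primes_upto n. real (n div p) * ln p)"
  proof (intro sum_mono mult_right_mono)
    fix p assume p: "p \<in> primes_upto n"
    hence "p > 0" by (auto simp: prime_gt_0_nat)
    hence "n div p > 0" using p by (auto simp: div_greater_zero_iff)
    hence "p \<le> n div p * p" by simp
    moreover have "n < n div p * p + p" using div_mult_mod_eq[of n p] \<open>p > 0\<close>
      by (metis add_less_cancel_left mod_less_divisor)
    ultimately have "n \<le> 2 * (n div p * p)" by linarith
    hence "n \<le> 2 * p * (n div p)" by (simp add: mult_ac)
    hence "real n \<le> real (2 * p * (n div p))" by (rule of_nat_mono)
    thus "n / (2 * p) \<le> real (n div p)" using \<open>p > 0\<close> by (simp add: field_simps)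
    show "ln (real p) \<ge> 0" using \<open>p > 0\<close> by simp
  qed
  also note *
  finally show ?thesis using assms by (simp add: field_simps)
qed

section \<open>Upper bound for the full Euler product over the primes\<close>

lemma sum_Pow_insert:
  fixes f :: "'a set \<Rightarrow> real"
  assumes "finite R" "r \<notin> R"
  shows   "(\<Sum>D\<in>Pow (insert r R). f D) = (\<Sum>D\<in>Pow R. f D) + (\<Sum>D\<in>Pow R. f (insert r D))"
proof -
  have "(\<Sum>D\<in>Pow (insert r R). f D) = (\<Sum>D\<in>Pow R. f D) + (\<Sum>D\<in>insert r ` Pow R. f D)"
    unfolding Pow_insert using assms by (intro sum.union_disjoint) auto
  also have "(\<Sum>D\<in>insert r ` Pow R. f D) = (\<Sum>D\<in>Pow R. f (insert r D))"
    using assms(2) by (intro sum.reindex_cong[of "insert r"]) (auto simp: inj_on_def)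
  finally show ?thesis .
qed

lemma prod_1_plus_inverse_eq:
  assumes "finite R"
  shows   "(\<Prod>r\<in>R. 1 + 1 / real r) = (\<Sum>D\<in>Pow R. 1 / real (\<Prod>D))"
  using assms
proof (induction R rule: finite_induct)
  case (insert r R)
  have "(\<Sum>D\<in>Pow R. 1 / real (\<Prod>(insert r D))) = (\<Sum>D\<in>Pow R. 1 / r * (1 / real (\<Prod>D)))"
  proof (intro sum.cong refl)
    fix D assume "D \<in> Pow R"
    hence "finite D" "r \<notin> D" using insert.hyps finite_subset by auto
    thus "1 / real (\<Prod>(insert r D)) = 1 / r * (1 / real (\<Prod>D))" by simp
  qed
  also have "\<dots> = 1 / r * (\<Sum>D\<in>Pow R. 1 / real (\<Prod>D))" by (rule sum_distrib_left [symmetric])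
  finally have "(\<Sum>D\<in>Pow (insert r R). 1 / real (\<Prod>D)) = (1 + 1 / r) * (\<Sum>D\<in>Pow R. 1 / real (\<Prod>D))"
    using insert.hyps by (simp add: sum_Pow_insert distrib_right del: of_nat_prod)
  with insert show ?case by (simp del: of_nat_prod)
qed auto

text \<open>The logarithm of \<open>\<Prod>D\<close> is the sum of \<open>ln r\<close> over
  \<open>r\<close> in \<open>D\<close>. For fixed \<open>r\<close>, the sets containing
  \<open>r\<close> have total weight at most 1/r times the full product. In the induction the only
  loss beyond the induction hypothesis is \<open>X \<le> (1 + 1 / r) * X\<close>.\<close>

lemma sum_Pow_ln_le:
  assumes "finite R" "\<And>r. r \<in> R \<Longrightarrow> r > 0"
  shows   "(\<Sum>D\<in>Pow R. ln (real (\<Prod>D)) / real (\<Prod>D)) \<le> (\<Sum>r\<in>R. ln r / r) * (\<Prod>r\<in>R. 1 + 1 / real r)"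
  using assms
proof (induction R rule: finite_induct)
  case (insert r R)
  define X where "X = (\<Prod>r\<in>R. 1 + 1 / real r)"
  define Y where "Y = (\<Sum>D\<in>Pow R. ln (real (\<Prod>D)) / real (\<Prod>D))"
  define S where "S = (\<Sum>r\<in>R. ln r / real r)"
  have r: "r \<ge> 1" "ln (real r) \<ge> 0" using insert.prems[of r] by auto
  have X: "X = (\<Sum>D\<in>Pow R. 1 / real (\<Prod>D))" "X \<ge> 0"
    unfolding X_def using insert.hyps by (simp add: prod_1_plus_inverse_eq, intro prod_nonneg) auto
  have "(\<Sum>D\<in>Pow R. ln (real (\<Prod>(insert r D))) / real (\<Prod>(insert r D)))
          = (\<Sum>D\<in>Pow R. 1 / r * (ln (real (\<Prod>D)) / real (\<Prod>D)) + ln r / r * (1 / real (\<Prod>D)))"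
  proof (intro sum.cong refl)
    fix D assume "D \<in> Pow R"
    hence D: "finite D" "r \<notin> D" "real (\<Prod>D) > 0"
      using insert finite_subset by (auto intro!: prod_pos)
    define d where "d = real (\<Prod>D)"
    have "real (\<Prod>(insert r D)) = r * d" "d > 0" using D by (simp_all add: d_def)
    with r show "ln (real (\<Prod>(insert r D))) / real (\<Prod>(insert r D))
       = 1 / r * (ln (real (\<Prod>D)) / real (\<Prod>D)) + ln r / r * (1 / real (\<Prod>D))"
      unfolding d_def [symmetric] by (simp add: ln_mult add_divide_distrib)
  qed
  also have "\<dots> = 1 / r * Y + ln r / r * X"
    unfolding X Y_def sum.distrib sum_distrib_left ..
  finally have "(\<Sum>D\<in>Pow (insert r R). ln (real (\<Prod>D)) / real (\<Prod>D)) = Y + (1 / r * Y + ln r / r * X)"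
    using insert.hyps by (subst sum_Pow_insert) (simp_all add: Y_def)
  also have "\<dots> = (1 + 1 / r) * Y + ln r / r * X" by (simp add: algebra_simps)
  also have "\<dots> \<le> (1 + 1 / r) * (S * X) + ln r / r * ((1 + 1 / r) * X)"
  proof (intro add_mono mult_left_mono)
    show "Y \<le> S * X" unfolding X_def Y_def S_def using insert by auto
    show "X \<le> (1 + 1 / r) * X" using X(2) by (simp add: distrib_right)
  qed (use r in auto)
  also have "\<dots> = (S + ln r / r) * ((1 + 1 / r) * X)" by (simp add: algebra_simps)
  finally show ?case using insert.hyps by (simp add: S_def X_def add.commute)
qed auto

text \<open>
  With \<open>X\<close> the product in question, the mean of \<open>ln d\<close> over the squarefree \<open>n\<close>-smooth \<open>d\<close> with weights
  \<open>1/d\<close> is at most \<open>2 ln n\<close>, so by Markov's inequality those with \<open>d > n\<^sup>4\<close> contribute at most half of \<open>X\<close>.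
\<close>

lemma prod_primes_le:
  assumes "n \<ge> 2"
  shows   "(\<Prod>p\<in>primes_upto n. 1 + 1 / real p) \<le> 2 + 8 * ln n"
proof -
  define P where "P = primes_upto n"
  define X where "X = (\<Prod>p\<in>P. 1 + 1 / real p)"
  define T where "T = {D \<in> Pow P. \<Prod>D \<le> n ^ 4}"
  have fin: "finite P" "finite T" "finite (Pow P)"
    unfolding T_def P_def using finite_primes_upto by auto
  have D: "finite D" "\<And>p. p \<in> D \<Longrightarrow> prime p" "\<Prod>D > 0" if "D \<in> Pow P" for D
    using that finite_subset[OF _ fin(1), of D] prime_gt_0_nat by (auto simp: P_def intro!: prod_pos)
  have ln: "ln (real n) > 0" using assms by simp
  have "4 * ln n * (\<Sum>D\<in>Pow P - T. 1 / real (\<Prod>D)) \<le> (\<Sum>D\<in>Pow P - T. ln (real (\<Prod>D)) / real (\<Prod>D))"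
    unfolding sum_distrib_left
  proof (intro sum_mono)
    fix D assume D': "D \<in> Pow P - T"
    hence "n ^ 4 \<le> \<Prod>D" by (auto simp: T_def)
    hence "real (n ^ 4) \<le> real (\<Prod>D)" by (rule of_nat_mono)
    moreover have "real (\<Prod>D) > 0" using D(3)[of D] D' by (simp del: of_nat_prod)
    ultimately have "ln (real (n ^ 4)) \<le> ln (real (\<Prod>D))"
      using assms by (subst ln_le_cancel_iff) auto
    hence "4 * ln n \<le> ln (real (\<Prod>D))" using assms by (simp add: ln_realpow)
    thus "4 * ln n * (1 / real (\<Prod>D)) \<le> ln (real (\<Prod>D)) / real (\<Prod>D)"
      by (simp add: divide_right_mono prod_nonneg)
  qed
  also have "\<dots> \<le> (\<Sum>D\<in>Pow P. ln (real (\<Prod>D)) / real (\<Prod>D))"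
    using fin D by (intro sum_mono2 divide_nonneg_nonneg ln_ge_zero) 
                   (force simp: Suc_le_eq simp del: of_nat_prod)+
  also have "\<dots> \<le> (\<Sum>p\<in>P. ln p / p) * X"
    unfolding X_def using fin prime_gt_0_nat by (intro sum_Pow_ln_le) (auto simp: P_def)
  also have "\<dots> \<le> (2 * ln n) * X"
    unfolding P_def using assms
    by (intro mult_right_mono sum_ln_prime_over_prime_le) (auto simp: X_def prod_nonneg)
  finally have tail: "(\<Sum>D\<in>Pow P - T. 1 / real (\<Prod>D)) \<le> X / 2"
    using ln by (simp add: field_simps)
  have "inj_on (\<lambda>D. \<Prod>D) T"
    using inj_on_Prod_primes by (rule inj_on_subset) (use D in \<open>auto simp: T_def\<close>)
  hence "(\<Sum>D\<in>T. 1 / real (\<Prod>D)) = (\<Sum>m\<in>(\<lambda>D. \<Prod>D) ` T. 1 / real m)"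
    by (subst sum.reindex) auto
  also have "\<dots> \<le> (\<Sum>m\<in>{1..n ^ 4}. 1 / real m)"
    using D(3) by (intro sum_mono2) (auto simp: T_def Suc_le_eq)
  also have "\<dots> = harm (n ^ 4)" by (simp add: harm_def divide_inverse)
  also have "\<dots> \<le> 1 + 4 * ln n" using harm_le_ln[of "n ^ 4"] assms by (simp add: ln_realpow)
  finally have main: "(\<Sum>D\<in>T. 1 / real (\<Prod>D)) \<le> 1 + 4 * ln n" .
  have "X = (\<Sum>D\<in>T. 1 / real (\<Prod>D)) + (\<Sum>D\<in>Pow P - T. 1 / real (\<Prod>D))"
    unfolding X_def prod_1_plus_inverse_eq[OF fin(1)]
    using fin by (subst sum.subset_diff[of T "Pow P"]) (auto simp: T_def)
  with tail main show ?thesis by (simp add: X_def P_def)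
qed

section \<open>Primes with restricted shifts\<close>

text \<open>Quantifying over finite subsets bounds the Euler product of a possibly infinite
  \<open>Q\<close> without any question of convergence.\<close>

definition euler_bounded :: "nat set \<Rightarrow> real \<Rightarrow> bool" where
  "euler_bounded Q E \<longleftrightarrow> (\<forall>R. finite R \<and> R \<subseteq> Q \<longrightarrow> (\<Prod>q\<in>R. 1 + 1 / real q) \<le> E)"

lemma euler_boundedD: "euler_bounded Q E \<Longrightarrow> finite R \<Longrightarrow> R \<subseteq> Q \<Longrightarrow> (\<Prod>q\<in>R. 1 + 1 / real q) \<le> E"
  by (simp add: euler_bounded_def)

lemma euler_bounded_ge_1: "euler_bounded Q E \<Longrightarrow> E \<ge> 1"
  using euler_boundedD[of Q E "{}"] by simp

text \<open>The step from one prime set of the tower to the next. The prime 2 always belongs, as 2 -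
  1 has no prime factor; from the empty set one obtains just {2}.\<close>

definition shifted_primes :: "nat set \<Rightarrow> nat set" where
  "shifted_primes Q = {p. prime p \<and> (\<forall>q. prime q \<longrightarrow> q dvd p - 1 \<longrightarrow> q \<in> Q)}"

text \<open>The sieving limit is the integer part of the 16th root of \<open>x\<close>: small enough
  for the error terms n^4 and n^8 of the sieve to stay below \<open>x\<close>, yet with
  \<open>ln n\<close> of order \<open>ln x\<close>. For \<open>n \<ge> 2\<close> the last point uses
  n + 1 \<le> n^2.\<close>

lemma sieve_level_exists:
  assumes "x \<ge> (2 :: nat)"
  obtains n :: nat where "n \<ge> 1" "n ^ 16 \<le> x" "n \<ge> 2 \<Longrightarrow> ln x \<le> 32 * ln n" "n = 1 \<Longrightarrow> ln x \<le> 16"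
proof
  define n where "n = nat \<lfloor>root 16 (real x)\<rfloor>"
  have n: "real n \<le> root 16 x" "root 16 x < real n + 1"
    unfolding n_def by (simp_all add: of_nat_nat)
  have "root 16 x \<ge> 1" using assms by simp
  thus "n \<ge> 1" by (simp add: n_def le_nat_floor)
  have "real n ^ 16 \<le> root 16 x ^ 16" using n(1) by (intro power_mono) auto
  also have "\<dots> = x" by (subst real_root_pow_pos2) auto
  finally show "n ^ 16 \<le> x" by (simp flip: of_nat_power)
  have "real x = root 16 x ^ 16" by (subst real_root_pow_pos2) auto
  also have "\<dots> \<le> (real n + 1) ^ 16" using n(2) by (intro power_mono) auto
  finally have x: "real x \<le> (real n + 1) ^ 16" .
  have "ln x \<le> ln ((real n + 1) ^ 16)" using x assms by (subst ln_le_cancel_iff) auto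
  hence ln: "ln x \<le> 16 * ln (real n + 1)" by (simp add: ln_realpow)
  show "ln x \<le> 32 * ln n" if "n \<ge> 2"
  proof -
    have "real n + 1 \<le> real n * real n"
      using that mult_right_mono[of 2 "real n" "real n"] by linarith
    hence "ln (real n + 1) \<le> ln (real n ^ 2)"
      using that by (subst ln_le_cancel_iff) (auto simp: power2_eq_square)
    also have "\<dots> = 2 * ln n" using that by (simp add: ln_realpow)
    finally show ?thesis using ln by simp
  qed
  show "ln x \<le> 16" if "n = 1"
    using ln that ln_2_less_1 by simp
qed

text \<open>Such a prime \<open>p > n\<close> avoids the class 0 modulo every prime
  \<open>r \<le> n\<close>, and also the class 1 if \<open>r\<close> is not in \<open>Q\<close>, as
  \<open>r\<close> would divide \<open>p - 1\<close>. Two classes are thus removed outside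
  \<open>Q\<close>, which saves the square of the logarithm up to the Euler product over
  \<open>Q\<close>.\<close>

lemma card_shifted_primes_le:
  assumes Q: "euler_bounded Q E" and x: "(x :: nat) \<ge> 2"
  shows   "real (card {p \<in> shifted_primes Q. p \<le> x}) \<le> 30000 * E * x / ln x ^ 2"
proof -
  obtain n where n: "n \<ge> 1" "n ^ 16 \<le> x" "n \<ge> 2 \<Longrightarrow> ln x \<le> 32 * ln n" "n = 1 \<Longrightarrow> ln x \<le> 16"
    using sieve_level_exists[OF x] by metis
  define S where "S = {p \<in> shifted_primes Q. p \<le> x}"
  have S: "finite S" "card S \<le> x"
  proof -
    have sub: "S \<subseteq> {1..x}" using prime_gt_0_nat by (auto simp: S_def shifted_primes_def Suc_le_eq)
    thus "finite S" by (rule finite_subset) auto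
    show "card S \<le> x" using card_mono[OF _ sub] by simp
  qed
  have E: "E \<ge> 1" using Q by (rule euler_bounded_ge_1)
  have lnx: "ln x > 0" using x by simp
  show ?thesis
  proof (cases "n = 1")
    case True
    \<comment> \<open>Here \<open>x\<close> is bounded, and the trivial count \<open>x\<close> is
      already within the claim.\<close>
    have "ln x ^ 2 \<le> 16 ^ 2" using n(4) True lnx by (intro power_mono) auto
    also have "\<dots> \<le> 30000 * E" using E by simp
    finally have "real x * ln x ^ 2 \<le> real x * (30000 * E)" by (intro mult_left_mono) auto
    hence "real x \<le> 30000 * E * x / ln x ^ 2" using lnx by (simp add: field_simps)
    with S(2) show ?thesis by (simp add: S_def)
  next
    case False
    with n have n2: "n \<ge> 2" "ln x \<le> 32 * ln n" by auto
    define R where "R = primes_upto n"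
    \<comment> \<open>The class of 1 is not removed modulo 2 and 3, to keep at most half of the residue classes forbidden.\<close>
    define W where "W r = (if r \<in> Q \<union> {2, 3} then {0} else {0, 1 :: nat})" for r :: nat
    define g where "g r = real (card (W r)) / (real r - real (card (W r)))" for r
    define G where "G = truncsum R g (real n * real n)"
    have R: "finite R" "\<And>r. r \<in> R \<Longrightarrow> prime r" using finite_primes_upto by (auto simp: R_def)
    have ge5: "r \<ge> 5" if "r \<in> R" "r \<noteq> 2" "r \<noteq> 3" for r
    proof -
      have "r \<noteq> 4" using R(2)[OF that(1)] prime_odd_nat[of 4] by auto
      thus ?thesis using R(2)[OF that(1)] that prime_ge_2_nat[of r] by linarith
    qed
    have cardW: "card (W r) = (if r \<in> Q \<union> {2, 3} then 1 else 2)" for r by (simp add: W_def)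
    have g1: "g r \<ge> 1 / r" if "r \<in> R" for r
    proof (cases "r \<in> Q \<union> {2, 3}")
      case True
      thus ?thesis unfolding g_def cardW using prime_ge_2_nat[OF R(2)[OF that]]
        by (auto intro!: frac_le)
    next
      case False
      thus ?thesis unfolding g_def cardW using ge5[OF that] by (auto intro!: frac_le)
    qed
    have g2: "g r \<ge> 2 / r + 1 / r ^ 2" if "r \<in> R" "r \<notin> Q \<union> {2, 3}" for r
    proof -
      have r: "real r \<ge> 5" using ge5[OF that(1)] that(2) by auto
      have "(2 * real r + 1) * (real r - 2) \<le> 2 * r ^ 2" using r by (simp add: algebra_simps power2_eq_square)
      hence "(2 * real r + 1) / r ^ 2 \<le> 2 / (real r - 2)" using r by (simp add: field_simps)
      moreover have "(2 * real r + 1) / r ^ 2 = 2 / r + 1 / r ^ 2"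
        using r by (simp add: field_simps power2_eq_square)
      ultimately show ?thesis using that(2) unfolding g_def cardW by simp
    qed
    \<comment> \<open>Treating 2 and 3 like members of \<open>Q\<close> costs at most the factor (1
      + 1/2)(1 + 1/3) = 2.\<close>
    have "(\<Prod>q\<in>R \<inter> (Q \<union> {2, 3}). 1 + 1 / real q) \<le> (\<Prod>q\<in>R \<inter> Q. 1 + 1 / real q) * (\<Prod>q\<in>{2,3}. 1 + 1 / real q)"
    proof -
      have "(\<Prod>q\<in>R \<inter> (Q \<union> {2, 3}). 1 + 1 / real q)
              = (\<Prod>q\<in>R \<inter> Q. 1 + 1 / real q) * (\<Prod>q\<in>(R \<inter> {2,3}) - Q. 1 + 1 / real q)"
        using R by (subst prod.union_disjoint[symmetric]) (auto intro!: prod.cong)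
      also have "\<dots> \<le> (\<Prod>q\<in>R \<inter> Q. 1 + 1 / real q) * (\<Prod>q\<in>{2,3}. 1 + 1 / real q)"
        by (intro mult_left_mono prod_mono2 prod_nonneg) auto
      finally show ?thesis .
    qed
    also have "\<dots> \<le> E * 2"
      using R euler_boundedD[OF Q, of "R \<inter> Q"] E by (intro mult_mono) auto
    finally have P: "(\<Prod>q\<in>R \<inter> (Q \<union> {2, 3}). 1 + 1 / real q) \<le> E * 2" .

    \<comment> \<open>The sieve level \<open>n * n\<close> leaves room for a product of two
      truncated sums of level \<open>n\<close>. Together with \<open>ln x \<le> 32 * ln n\<close>
      this produces the constant 8 * 32^2 = 8192.\<close>
    have "(ln n / 2) * (ln n / 2) \<le> truncsum R (\<lambda>r. 1 / r) n * truncsum R (\<lambda>r. 1 / r) n"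
      unfolding R_def using n by (intro mult_mono ln_le_truncsum_primes truncsum_nonneg) auto
    also have "\<dots> \<le> G * (\<Prod>q\<in>R \<inter> (Q \<union> {2, 3}). 1 + 1 / real q)"
      unfolding G_def using R g1 g2 by (intro truncsum_mult_le_truncsum_times_prod) (auto simp: prime_gt_0_nat)
    also have "\<dots> \<le> G * (E * 2)"
    proof (intro mult_left_mono P)
      show "G \<ge> 0" unfolding G_def
        by (intro truncsum_nonneg order_trans[OF _ g1]) auto
    qed
    finally have "ln n ^ 2 \<le> 8 * E * G" by (simp add: power2_eq_square mult_ac)
    moreover have "(ln x / 32) ^ 2 \<le> ln n ^ 2" using n2 lnx by (intro power_mono) auto
    ultimately have G: "ln x ^ 2 \<le> 8192 * E * G" by (simp add: power_divide)
    hence "E * G > 0" using lnx zero_less_power[of "ln x" 2] by linarith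
    hence Gpos: "G > 0" using E by (simp add: zero_less_mult_iff)
    have G1: "G \<ge> 1" unfolding G_def
    proof (intro truncsum_ge_1 R order_trans[OF _ g1])
      show "1 \<le> real n * real n" using n(1) mult_mono[of 1 "real n" 1 "real n"] by simp
    qed auto

    \<comment> \<open>A prime \<open>p \<le> n\<close> lies in the removed class 0 modulo itself, so
      these primes are set apart and counted trivially.\<close>
    define A where "A = {p \<in> S. p > n}"
    have "real (card A) \<le> real (Suc x) / G + (real n * real n) ^ 4 / G ^ 2"
      unfolding G_def g_def
    proof (rule selberg_sieve)
      show "m mod r \<notin> W r" if "m \<in> A" "r \<in> R" for m r
      proof -
        have m: "prime m" "m > n" "\<And>q. prime q \<Longrightarrow> q dvd m - 1 \<Longrightarrow> q \<in> Q"
          using that by (auto simp: A_def S_def shifted_primes_def)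
        have r: "prime r" "r \<le> n" using that by (auto simp: R_def)
        have "\<not> r dvd m" using m r primes_dvd_imp_eq[of r m] by auto
        moreover have "m mod r \<noteq> 1" if "r \<notin> Q"
        proof
          assume "m mod r = 1"
          hence "r dvd m - 1" using dvd_minus_mod[of r m] by simp
          with m(3) r that show False by auto
        qed
        ultimately show ?thesis by (auto simp: W_def dvd_eq_mod_eq_0)
      qed
    next
      fix r assume "r \<in> R"
      with ge5[of r] prime_ge_2_nat[OF R(2), of r] show "W r \<subseteq> {..<r}" "2 * card (W r) \<le> r"
        unfolding cardW by (auto simp: W_def)
    next
      show "1 \<le> real n * real n" using n(1) mult_mono[of 1 "real n" 1 "real n"] by simp
    qed (use R in \<open>auto simp: A_def S_def\<close>)
    also have "\<dots> \<le> 2 * real x / G + real x / G"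
    proof (intro add_mono divide_right_mono)
      have "real (n ^ 8) \<le> real (n ^ 16)"
        using n(1) by (intro of_nat_mono power_increasing) auto
      also have "\<dots> \<le> real x" using n(2) by (rule of_nat_mono)
      finally have "(real n * real n) ^ 4 \<le> real x" by (simp flip: power_add add: power_mult_distrib)
      moreover have "G \<le> G ^ 2" using G1 by (simp add: power2_eq_square)
      ultimately show "(real n * real n) ^ 4 / G ^ 2 \<le> real x / G"
        using Gpos by (intro frac_le) auto
    qed (use x Gpos in auto)
    also have "\<dots> = 3 * x * (1 / G)" by simp
    also have "\<dots> \<le> 3 * x * (8192 * E / ln x ^ 2)"
      using G Gpos lnx by (intro mult_left_mono) (auto simp: field_simps)
    finally have A: "real (card A) \<le> 24576 * E * x / ln x ^ 2" by (simp add: mult_ac)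

    \<comment> \<open>From ln y \<le> y at the fourth root of \<open>x\<close>; it serves to absorb
      the at most \<open>n\<close> small primes into x / (ln x)^2.\<close>
    have "ln (sqrt (sqrt x)) = ln x / 4" using x by (subst ln_sqrt, simp, subst ln_sqrt) auto
    hence "ln x = 4 * ln (sqrt (sqrt x))" by simp
    also have "\<dots> \<le> 4 * sqrt (sqrt x)"
      using x by (intro mult_left_mono) (auto intro!: order.strict_implies_order ln_less_self)
    finally have "ln x ^ 2 \<le> (4 * sqrt (sqrt x)) ^ 2" using lnx by (intro power_mono) auto
    hence lnx2: "ln x ^ 2 \<le> 16 * sqrt x" by (simp add: power_mult_distrib)
    have "real n \<le> sqrt x"
    proof (rule real_le_rsqrt)
      have "n ^ 2 \<le> n ^ 16" using n(1) by (intro power_increasing) auto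
      with n(2) have "n ^ 2 \<le> x" by linarith
      thus "real n ^ 2 \<le> real x" by (simp flip: of_nat_power)
    qed
    hence "n * ln x ^ 2 \<le> sqrt x * (16 * sqrt x)"
      using lnx2 by (intro mult_mono) auto
    also have "\<dots> = 16 * x" by simp
    finally have n_le: "real n \<le> 16 * x / ln x ^ 2" using lnx by (simp add: field_simps)

    have "card S \<le> card ({1..n} \<union> A)"
      using S(1) prime_gt_0_nat
      by (intro card_mono) (auto simp: A_def S_def shifted_primes_def Suc_le_eq)
    also have "\<dots> \<le> n + card A" using card_Un_le[of "{1..n}" A] by simp
    finally have "real (card S) \<le> real n + real (card A)" by simp
    also have "\<dots> \<le> 16 * x / ln x ^ 2 + 24576 * E * x / ln x ^ 2"
      by (intro add_mono n_le A)
    also have "\<dots> = (16 + 24576 * E) * x / ln x ^ 2" by (simp add: add_divide_distrib distrib_right)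
    also have "\<dots> \<le> 30000 * E * x / ln x ^ 2"
      using E by (intro divide_right_mono mult_right_mono) auto
    finally show ?thesis by (simp add: S_def)
  qed
qed

text \<open>A number with all prime factors in \<open>Q\<close> avoids the class 0 modulo each prime
  \<open>r \<le> n\<close> outside \<open>Q\<close>. With one class removed there, the sieve
  denominator is at least ln n / (2E).\<close>

lemma card_smooth_le:
  assumes Q: "euler_bounded Q E" and x: "(x :: nat) \<ge> 2"
  shows   "real (card {m \<in> {1..x}. \<forall>p. prime p \<longrightarrow> p dvd m \<longrightarrow> p \<in> Q}) \<le> 192 * E * x / ln x"
proof -
  obtain n where n: "n \<ge> 1" "n ^ 16 \<le> x" "n \<ge> 2 \<Longrightarrow> ln x \<le> 32 * ln n" "n = 1 \<Longrightarrow> ln x \<le> 16"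
    using sieve_level_exists[OF x] by metis
  define S where "S = {m \<in> {1..x}. \<forall>p. prime p \<longrightarrow> p dvd m \<longrightarrow> p \<in> Q}"
  have "card S \<le> card {1..x}" by (intro card_mono) (auto simp: S_def)
  hence S: "card S \<le> x" by simp
  have E: "E \<ge> 1" using Q by (rule euler_bounded_ge_1)
  have lnx: "ln x > 0" using x by simp
  show ?thesis
  proof (cases "n = 1")
    case True
    have "ln x \<le> 192 * E" using n(4) True E by simp
    hence "real x * ln x \<le> real x * (192 * E)" by (intro mult_left_mono) auto
    hence "real x \<le> 192 * E * x / ln x" using lnx by (simp add: field_simps)
    with S show ?thesis by (simp add: S_def)
  next
    case False
    with n have n2: "n \<ge> 2" "ln x \<le> 32 * ln n" by auto
    define R where "R = primes_upto n"
    define W where "W r = (if r \<in> Q then {} else {0 :: nat})" for r :: nat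
    define g where "g r = real (card (W r)) / (real r - real (card (W r)))" for r
    define G where "G = truncsum R g (real n)"
    have R: "finite R" "\<And>r. r \<in> R \<Longrightarrow> prime r" "\<And>r. r \<in> R \<Longrightarrow> r \<ge> 2"
      using finite_primes_upto prime_ge_2_nat by (auto simp: R_def)
    have g0: "g r \<ge> 0" if "r \<in> R" for r
      using R(3)[OF that] by (auto simp: g_def W_def)
    have g1: "g r \<ge> 1 / r" if "r \<in> R" "r \<notin> Q" for r
      using R(3)[OF that(1)] that(2) by (auto simp: g_def W_def intro!: frac_le)
    have G1: "G \<ge> 1" unfolding G_def using R g0 n by (intro truncsum_ge_1) auto
    have "ln n / 2 \<le> truncsum R (\<lambda>r. 1 / r) n"
      unfolding R_def using n by (intro ln_le_truncsum_primes) auto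
    also have "\<dots> \<le> G * (\<Prod>q\<in>R \<inter> Q. 1 + 1 / real q)"
      unfolding G_def using R g0 g1 by (intro truncsum_le_truncsum_times_prod) (auto simp: prime_gt_0_nat)
    also have "\<dots> \<le> G * E"
      using R euler_boundedD[OF Q, of "R \<inter> Q"] G1 by (intro mult_left_mono) auto
    finally have G: "ln x \<le> 64 * E * G" using n2 by (simp add: mult_ac)
    have "real (card S) \<le> real (Suc x) / G + real n ^ 4 / G ^ 2"
      unfolding G_def g_def
    proof (rule selberg_sieve)
      show "m mod r \<notin> W r" if "m \<in> S" "r \<in> R" for m r
        using that R(2)[of r] by (auto simp: W_def S_def dvd_eq_mod_eq_0)
      show "W r \<subseteq> {..<r}" "2 * card (W r) \<le> r" if "r \<in> R" for r
        using R(3)[OF that] by (auto simp: W_def)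
    qed (use R n in \<open>auto simp: S_def\<close>)
    also have "\<dots> \<le> 2 * real x / G + real x / G"
    proof (intro add_mono divide_right_mono)
      have "real (n ^ 4) \<le> real (n ^ 16)"
        using n(1) by (intro of_nat_mono power_increasing) auto
      also have "\<dots> \<le> real x" using n(2) by (rule of_nat_mono)
      finally have "real n ^ 4 \<le> real x" by simp
      moreover have "G \<le> G ^ 2" using G1 by (simp add: power2_eq_square)
      ultimately show "real n ^ 4 / G ^ 2 \<le> real x / G"
        using G1 by (intro frac_le) auto
    qed (use x G1 in auto)
    also have "\<dots> = 3 * x * (1 / G)" by simp
    also have "\<dots> \<le> 3 * x * (64 * E / ln x)"
      using G G1 lnx by (intro mult_left_mono) (auto simp: field_simps)
    finally show ?thesis by (simp add: S_def mult_ac)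
  qed
qed

text \<open>Dyadic decomposition: by the sieve bound the members of \<open>R\<close> in (2^J,
  2^(J+1)] contribute at most 240000 E / (J+1)^2, and these bounds telescope against 1/J -
  1/(J+1).\<close>

lemma sum_shifted_primes_tail_le:
  assumes Q: "euler_bounded Q E" and "I \<ge> 1" and R: "finite R" "R \<subseteq> shifted_primes Q"
  shows   "(\<Sum>q | q \<in> R \<and> q > 2 ^ I. 1 / real q) \<le> 240000 * E / I"
proof -
  have E: "E \<ge> 1" using Q by (rule euler_bounded_ge_1)
  have split: "(\<Sum>q | q \<in> R \<and> a < q \<and> q \<le> c. 1 / real q)
      = (\<Sum>q | q \<in> R \<and> a < q \<and> q \<le> b. 1 / real q) + (\<Sum>q | q \<in> R \<and> b < q \<and> q \<le> c. 1 / real q)"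
    if "a \<le> b" "b \<le> c" for a b c :: nat
  proof -
    have "{q. q \<in> R \<and> a < q \<and> q \<le> c} = {q. q \<in> R \<and> a < q \<and> q \<le> b} \<union> {q. q \<in> R \<and> b < q \<and> q \<le> c}"
      using that by auto
    thus ?thesis using R(1) by (simp add: sum.union_disjoint disjoint_iff)
  qed
  have *: "(\<Sum>q | q \<in> R \<and> 2 ^ I < q \<and> q \<le> 2 ^ J. 1 / real q) \<le> 240000 * E * (1 / I - 1 / J)"
    if "J \<ge> I" for J
    using that
  proof (induction J rule: dec_induct)
    case base
    have "{q. q \<in> R \<and> 2 ^ I < q \<and> q \<le> 2 ^ I} = {}" by auto
    thus ?case by (simp only: sum.empty diff_self mult_zero_right)
  next
    case (step J)
    define B where "B = {q \<in> R. 2 ^ J < q \<and> q \<le> 2 ^ Suc J}"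
    have J: "J \<ge> 1" using step assms by simp
    have le: "2 ^ I \<le> (2 :: nat) ^ J" "2 ^ J \<le> (2 :: nat) ^ Suc J"
      using step by (intro power_increasing; simp)+
    from split[OF le] have "(\<Sum>q | q \<in> R \<and> 2 ^ I < q \<and> q \<le> 2 ^ Suc J. 1 / real q)
             = (\<Sum>q | q \<in> R \<and> 2 ^ I < q \<and> q \<le> 2 ^ J. 1 / real q) + (\<Sum>q\<in>B. 1 / real q)"
      unfolding B_def .
    also have "(\<Sum>q\<in>B. 1 / real q) \<le> (\<Sum>q\<in>B. 1 / 2 ^ J)"
    proof (intro sum_mono frac_le)
      fix q assume "q \<in> B"
      hence "(2 :: nat) ^ J \<le> q" by (simp add: B_def)
      hence "real (2 ^ J) \<le> real q" by (rule of_nat_mono)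
      thus "2 ^ J \<le> real q" by simp
    qed auto
    also have "\<dots> = real (card B) / 2 ^ J" by simp
    also have "real (card B) \<le> 120000 * E * 2 ^ Suc J / (Suc J) ^ 2"
    proof -
      have fin: "finite {p \<in> shifted_primes Q. p \<le> 2 ^ Suc J}"
        by (rule finite_subset[of _ "{..2 ^ Suc J}"]) auto
      have "card B \<le> card {p \<in> shifted_primes Q. p \<le> 2 ^ Suc J}"
        using R(2) by (intro card_mono fin) (auto simp: B_def)
      also have "real \<dots> \<le> 30000 * E * real (2 ^ Suc J) / ln (real (2 ^ Suc J)) ^ 2"
        by (rule card_shifted_primes_le[OF Q]) simp
      also have "ln (real (2 ^ Suc J)) = Suc J * ln 2" by (simp add: ln_realpow del: power_Suc)
      \<comment> \<open>Replacing \<open>ln 2\<close> by 1/2 costs a factor 4 at most; the block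
        length 2^(J+1) relative to 2^J later adds a factor 2, giving 240000.\<close>
      also have "30000 * E * real (2 ^ Suc J) / (Suc J * ln 2) ^ 2
                   \<le> 30000 * E * real (2 ^ Suc J) / (Suc J * (1 / 2)) ^ 2"
        using E ln2_ge_two_thirds
        by (intro divide_left_mono power_mono mult_left_mono mult_nonneg_nonneg mult_pos_pos) auto
      also have "\<dots> = 120000 * E * 2 ^ Suc J / (Suc J) ^ 2"
        by (simp add: power_divide power_mult_distrib)
      finally show ?thesis by simp
    qed
    hence "real (card B) / 2 ^ J \<le> (120000 * E * 2 ^ Suc J / (Suc J) ^ 2) / 2 ^ J"
      by (intro divide_right_mono) auto
    also have "\<dots> = 240000 * E * (1 / (Suc J) ^ 2)" by simp
    also have "\<dots> \<le> 240000 * E * (1 / J - 1 / Suc J)"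
    proof (intro mult_left_mono)
      have "1 / real (Suc J) ^ 2 \<le> 1 / (real J * real (Suc J))"
        using J by (intro frac_le) (auto simp: power2_eq_square)
      also have "\<dots> = 1 / J - 1 / real (Suc J)" using J by (simp add: field_simps)
      finally show "1 / real ((Suc J) ^ 2) \<le> 1 / J - 1 / real (Suc J)" by simp
    qed (use E in auto)
    finally show ?case using step.IH by (simp add: algebra_simps)
  qed
  \<comment> \<open>\<open>R\<close> is finite, and the sum of its elements is a convenient exponent
    with 2^J above all of them.\<close>
  define J where "J = I + \<Sum>R"
  have "q \<le> 2 ^ J" if "q \<in> R" for q
  proof -
    have "q \<le> \<Sum>R" using R(1) that by (intro member_le_sum) auto
    also have "\<dots> \<le> J" by (simp add: J_def)
    also have "\<dots> \<le> 2 ^ J" using less_exp[of J] by simp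
    finally show ?thesis .
  qed
  hence "{q. q \<in> R \<and> q > 2 ^ I} = {q. q \<in> R \<and> 2 ^ I < q \<and> q \<le> 2 ^ J}" by auto
  hence "(\<Sum>q | q \<in> R \<and> q > 2 ^ I. 1 / real q) \<le> 240000 * E * (1 / I - 1 / J)"
    using *[of J] by (simp add: J_def)
  also have "\<dots> \<le> 240000 * E * (1 / I)" using E by (intro mult_left_mono) auto
  finally show ?thesis by simp
qed

section \<open>Growth of the Euler product in one step\<close>

definition growth_const :: real where
  "growth_const = 18 * exp 240000"

lemma growth_const_gt_1: "growth_const > 1"
proof -
  have "exp (240000 :: real) > 1" by (subst one_less_exp_iff) simp
  thus ?thesis unfolding growth_const_def by linarith
qed

text \<open>The cut at 2^I with \<open>I\<close> close to \<open>E\<close> keeps the growth linear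
  in \<open>E\<close>. Below it, Mertens over all primes gives at most 2 + 8I \<le> 18E; beyond it,
  the sum of reciprocals is at most 240000 E / I \<le> 240000, independently of
  \<open>E\<close>.\<close>

lemma euler_bounded_shifted_primes:
  assumes "euler_bounded Q E"
  shows   "euler_bounded (shifted_primes Q) (growth_const * E)"
  unfolding euler_bounded_def growth_const_def
proof (intro allI impI)
  fix R assume R: "finite R \<and> R \<subseteq> shifted_primes Q"
  have E: "E \<ge> 1" using assms by (rule euler_bounded_ge_1)
  define I where "I = nat \<lceil>E\<rceil>"
  have I: "E \<le> I" "I \<le> 2 * E" "I \<ge> 1" using E unfolding I_def by linarith+
  define R1 R2 where "R1 = {q \<in> R. q \<le> 2 ^ I}" and "R2 = {q \<in> R. q > 2 ^ I}"
  have "R1 \<union> R2 = R" by (auto simp: R1_def R2_def)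
  hence "(\<Prod>q\<in>R. 1 + 1 / real q) = (\<Prod>q\<in>R1. 1 + 1 / real q) * (\<Prod>q\<in>R2. 1 + 1 / real q)"
    using R by (subst prod.union_disjoint[symmetric]) (auto simp: R1_def R2_def)
  also have "\<dots> \<le> (18 * E) * exp 240000"
  proof (intro mult_mono)
    have "(\<Prod>q\<in>R1. 1 + 1 / real q) \<le> (\<Prod>p\<in>primes_upto (2 ^ I). 1 + 1 / real p)"
      using R by (intro prod_mono2 finite_primes_upto) (auto simp: R1_def shifted_primes_def)
    also have "\<dots> \<le> 2 + 8 * ln (real (2 ^ I))"
      using I(3) power_increasing[of 1 I "2 :: nat"] by (intro prod_primes_le) auto
    also have "ln (real (2 ^ I)) = I * ln 2" by (simp add: ln_realpow)
    also have "2 + 8 * (I * ln 2) \<le> 2 + 8 * (real I * 1)"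
      using ln_2_less_1 by (intro add_mono mult_left_mono) auto
    also have "\<dots> \<le> 18 * E" using I E by linarith
    finally show "(\<Prod>q\<in>R1. 1 + 1 / real q) \<le> 18 * E" by simp
    have "(\<Prod>q\<in>R2. 1 + 1 / real q) \<le> (\<Prod>q\<in>R2. exp (1 / real q))"
      by (intro prod_mono) (auto intro: exp_ge_add_one_self)
    also have "\<dots> = exp (\<Sum>q\<in>R2. 1 / real q)" using R by (simp add: exp_sum R2_def)
    also have "(\<Sum>q\<in>R2. 1 / real q) \<le> 240000 * E / I"
      unfolding R2_def using R assms I by (intro sum_shifted_primes_tail_le) auto
    also have "\<dots> \<le> 240000" using I E by (simp add: field_simps)
    finally show "(\<Prod>q\<in>R2. 1 + 1 / real q) \<le> exp 240000" by simp
  qed (use E in \<open>auto intro!: prod_nonneg\<close>)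
  finally show "(\<Prod>q\<in>R. 1 + 1 / real q) \<le> 18 * exp 240000 * E" by (simp add: mult_ac)
qed

section \<open>Iterates of the Carmichael function\<close>

text \<open>Splitting off the full power of \<open>p\<close> reduces this to prime powers, where the
  explicit value of \<open>Carmichael\<close> applies; for p = 2 the divisor is 1.\<close>

lemma prime_minus_1_dvd_Carmichael:
  assumes "prime p" "p dvd n" "n > 0"
  shows   "p - 1 dvd Carmichael n"
proof -
  define k where "k = multiplicity p n"
  obtain m where m: "n = p ^ k * m" "\<not> p dvd m"
    unfolding k_def using multiplicity_decompose'[of n p] assms not_prime_unit[of p]
    by (metis gr_implies_not0)
  have k: "k > 0" using assms by (auto simp: k_def prime_multiplicity_gt_zero_iff)
  have "coprime (p ^ k) m"
    using assms(1) m(2) by (intro coprime_power_left_iff[THEN iffD2] disjI1 prime_imp_coprime)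
  hence "Carmichael (p ^ k) dvd Carmichael n"
    unfolding m(1) by (simp add: Carmichael_mult_coprime)
  moreover have "p - 1 dvd Carmichael (p ^ k)"
    using assms(1) k by (auto simp: Carmichael_prime_power)
  ultimately show ?thesis by (rule dvd_trans[rotated])
qed

text \<open>A prime factor \<open>q\<close> of \<open>p - 1\<close> divides
  \<open>Carmichael n\<close>, which reaches 1 one step earlier, so the induction hypothesis puts
  \<open>q\<close> into the previous set. At the start n = 1 has no prime factor, in accordance with
  the empty set.\<close>

lemma carmichael_iter_eq_1_imp:
  assumes "carmichael_iter k n = 1" "prime p" "p dvd n" "n > 0"
  shows   "p \<in> (shifted_primes ^^ k) {}"
  using assms
proof (induction k arbitrary: n p)
  case 0
  thus ?case by (auto simp: carmichael_iter_def)
next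
  case (Suc k)
  have "carmichael_iter k (Carmichael n) = 1"
    using Suc.prems(1) by (simp add: carmichael_iter_def funpow_swap1)
  moreover have "q dvd Carmichael n" if "q dvd p - 1" for q
    using that prime_minus_1_dvd_Carmichael[OF Suc.prems(2-4)] by (rule dvd_trans)
  ultimately show ?case
    using Suc.IH[of "Carmichael n"] Suc.prems(2) by (auto simp: shifted_primes_def)
qed

text \<open>1 is a fixed point of \<open>Carmichael\<close>. This allows one common number of
  iterations for all \<open>n\<close> under consideration.\<close>

lemma carmichael_iter_eq_1_mono:
  assumes "carmichael_iter k n = 1" "k \<le> l"
  shows   "carmichael_iter l n = 1"
proof -
  have "(Carmichael ^^ j) 1 = 1" for j by (induction j) auto
  moreover have "l = (l - k) + k" using assms(2) by simp
  ultimately show ?thesis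
    using assms(1) unfolding carmichael_iter_def by (metis funpow_add comp_apply)
qed

lemma carmichael_iter_carmichael_L:
  assumes "n > 0"
  shows   "carmichael_iter (carmichael_L n) n = 1"
  unfolding carmichael_L_def using carmichael_iter_reaches_1[OF assms] by (rule LeastI_ex)

section \<open>The exceptional set and its density\<close>

lemma euler_bounded_funpow:
  "euler_bounded ((shifted_primes ^^ k) {}) (growth_const ^ k)"
proof (induction k)
  case 0
  show ?case by (auto simp: euler_bounded_def)
next
  case (Suc k)
  from euler_bounded_shifted_primes[OF this] show ?case by simp
qed

text \<open>Chosen so that \<open>growth_const\<close> to the power
  \<open>L_const * ln (ln N)\<close> is the square root of \<open>ln N\<close>, which uses up only
  half of the logarithmic saving of the sieve.\<close>

definition L_const :: real where
  "L_const = 1 / (2 * ln growth_const)"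

lemma L_const: "L_const > 0" "ln growth_const * L_const = 1 / 2"
proof -
  have "ln growth_const > 0" using growth_const_gt_1 by simp
  thus "L_const > 0" "ln growth_const * L_const = 1 / 2"
    by (simp_all add: L_const_def)
qed

definition exceptional :: "nat \<Rightarrow> nat set" where
  "exceptional N = {n. 3 \<le> n \<and> n \<le> N \<and> real (carmichael_L n) < L_const * ln (ln (real n))}"

text \<open>An exceptional \<open>n\<close> reaches 1 within \<open>K\<close> iterations, so all its
  prime factors lie in the \<open>K\<close>-th set, whose Euler product is at most
  \<open>growth_const ^ K\<close>, hence at most \<open>sqrt (ln N)\<close>. The count of such
  numbers loses this factor against the saving \<open>ln N\<close>.\<close>

lemma card_exceptional_le:
  assumes "N \<ge> 3"
  shows   "real (card (exceptional N)) \<le> 192 * N / sqrt (ln N)"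
proof -
  define c where "c = growth_const"
  define K where "K = nat \<lfloor>L_const * ln (ln (real N))\<rfloor>"
  define Q where "Q = (shifted_primes ^^ K) {}"
  have c: "c \<ge> 1" unfolding c_def using growth_const_gt_1 by simp
  have ln1: "ln (real n) > 1" if "n \<ge> 3" for n
  proof -
    have "exp 1 < real n" using e_less_272 that by simp
    thus ?thesis using that by (subst exp_less_cancel_iff[symmetric]) simp
  qed
  have lnN: "ln (real N) > 1" using ln1 assms by simp
  have "real K \<le> L_const * ln (ln (real N))"
    using lnN L_const(1) by (simp add: K_def)
  hence "c powr real K \<le> c powr (L_const * ln (ln (real N)))"
    using c by (intro powr_mono)
  also have "\<dots> = exp ((ln c * L_const) * ln (ln (real N)))"
    using c by (simp add: powr_def mult_ac)
  also have "\<dots> = sqrt (ln N)"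
    using lnN L_const(2) by (simp add: c_def powr_half_sqrt[symmetric] powr_def)
  finally have cK: "c ^ K \<le> sqrt (ln N)" using c by (simp add: powr_realpow)
  have "exceptional N \<subseteq> {m \<in> {1..N}. \<forall>p. prime p \<longrightarrow> p dvd m \<longrightarrow> p \<in> Q}"
  proof safe
    fix n assume "n \<in> exceptional N"
    hence n: "3 \<le> n" "n \<le> N" "real (carmichael_L n) < L_const * ln (ln (real n))"
      by (auto simp: exceptional_def)
    show "n \<in> {1..N}" using n by simp
    \<comment> \<open>Monotonicity makes the bound uniform in \<open>n \<le> N\<close>; since
      \<open>carmichael_L n\<close> is an integer, it survives rounding down to
      \<open>K\<close>.\<close>
    have "L_const * ln (ln (real n)) \<le> L_const * ln (ln (real N))"
      using L_const(1) ln1[of n] lnN n by (intro mult_left_mono) auto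
    with n have "carmichael_L n \<le> K" unfolding K_def by (intro le_nat_floor) simp
    hence "carmichael_iter K n = 1"
      using carmichael_iter_eq_1_mono[OF carmichael_iter_carmichael_L] n by simp
    moreover fix p assume "prime p" "p dvd n"
    ultimately show "p \<in> Q" unfolding Q_def using n by (intro carmichael_iter_eq_1_imp) auto
  qed
  hence "card (exceptional N) \<le> card {m \<in> {1..N}. \<forall>p. prime p \<longrightarrow> p dvd m \<longrightarrow> p \<in> Q}"
    by (intro card_mono) auto
  also have "real \<dots> \<le> 192 * c ^ K * N / ln N"
    unfolding Q_def c_def using assms by (intro card_smooth_le euler_bounded_funpow) auto
  also have "\<dots> \<le> 192 * sqrt (ln N) * N / ln N"
    using cK lnN by (intro divide_right_mono mult_right_mono mult_left_mono) auto
  also have "\<dots> = 192 * N / sqrt (ln N)"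
    using lnN by (simp add: field_simps flip: power2_eq_square)
  finally show ?thesis by simp
qed

lemma exceptional_density_0: "(\<lambda>N. real (card (exceptional N)) / real N) \<longlonglongrightarrow> 0"
proof (rule tendsto_sandwich[where f = "\<lambda>_. 0" and h = "\<lambda>N. 192 / sqrt (ln (real N))"])
  show "eventually (\<lambda>N. real (card (exceptional N)) / real N \<le> 192 / sqrt (ln (real N))) sequentially"
    using eventually_ge_at_top[of 3]
  proof eventually_elim
    case (elim N)
    thus ?case using card_exceptional_le[of N] by (simp add: field_simps)
  qed
  show "(\<lambda>N. 192 / sqrt (ln (real N))) \<longlonglongrightarrow> 0" by real_asymp
qed auto

theorem theorem2:
  shows "\<exists>c::real. c > 0 \<and>
    almost_all_nat (\<lambda>n. real (carmichael_L n) \<ge> c * ln (ln (real n))) \<and>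
    (\<lambda>x::real. real (card {n::nat. 3 \<le> n \<and> real n \<le> x \<and>
        real (carmichael_L n) < c * ln (ln (real n))})) \<in> o[at_top](\<lambda>x. x)"
proof (intro exI conjI)
  show "L_const > 0" by (rule L_const)
next
  define A where "A = {n. n > 0 \<and> real (carmichael_L n) \<ge> L_const * ln (ln (real n))}"
  have "(\<lambda>N. real (card (A \<inter> {1..N})) / real N) \<longlonglongrightarrow> 1"
  proof (rule tendsto_sandwich)
    show "eventually (\<lambda>N. 1 - 2 / real N - real (card (exceptional N)) / real N
            \<le> real (card (A \<inter> {1..N})) / real N) sequentially"
      using eventually_gt_at_top[of 0]
    proof eventually_elim
      case (elim N)
      \<comment> \<open>\<open>exceptional\<close> starts at 3, so 1 and 2 are allowed for
        separately, at a cost of 2/N in the density.\<close>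
      have "card {1..N} \<le> card (A \<inter> {1..N} \<union> ({1, 2} \<union> exceptional N))"
        by (intro card_mono) (auto simp: A_def exceptional_def)
      also have "\<dots> \<le> card (A \<inter> {1..N}) + (card {1, 2 :: nat} + card (exceptional N))"
        by (intro order_trans[OF card_Un_le] add_left_mono card_Un_le)
      finally have "real N \<le> real (card (A \<inter> {1..N})) + 2 + real (card (exceptional N))"
        by simp
      hence "(real N - 2 - real (card (exceptional N))) / real N \<le> real (card (A \<inter> {1..N})) / real N"
        by (intro divide_right_mono) auto
      thus ?case using elim by (simp add: diff_divide_distrib)
    qed
    show "eventually (\<lambda>N. real (card (A \<inter> {1..N})) / real N \<le> 1) sequentially"
      using eventually_gt_at_top[of 0]
    proof eventually_elim
      case (elim N)
      have "card (A \<inter> {1..N}) \<le> card {1..N}" by (intro card_mono) auto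
      thus ?case using elim by simp
    qed
    have "(\<lambda>N. 1 - 2 / real N) \<longlonglongrightarrow> 1" by real_asymp
    from tendsto_diff[OF this exceptional_density_0]
    show "(\<lambda>N. 1 - 2 / real N - real (card (exceptional N)) / real N) \<longlonglongrightarrow> 1" by simp
  qed auto
  thus "almost_all_nat (\<lambda>n. real (carmichael_L n) \<ge> L_const * ln (ln (real n)))"
    unfolding almost_all_nat_def has_asymptotic_density_def
    by (intro exI[of _ A]) (auto simp: A_def)
next
  have eq: "{n::nat. 3 \<le> n \<and> real n \<le> x \<and> real (carmichael_L n) < L_const * ln (ln (real n))}
          = exceptional (nat \<lfloor>x\<rfloor>)" if "x \<ge> 1" for x :: real
    using that by (auto simp: exceptional_def le_nat_floor le_nat_iff le_floor_iff)
  have lim: "filterlim (\<lambda>x::real. nat \<lfloor>x\<rfloor>) at_top at_top" by real_asymp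
  show "(\<lambda>x::real. real (card {n::nat. 3 \<le> n \<and> real n \<le> x \<and>
        real (carmichael_L n) < L_const * ln (ln (real n))})) \<in> o[at_top](\<lambda>x. x)"
  proof (rule smalloI_tendsto)
    show "((\<lambda>x. real (card {n::nat. 3 \<le> n \<and> real n \<le> x \<and>
        real (carmichael_L n) < L_const * ln (ln (real n))}) / x) \<longlongrightarrow> 0) at_top"
    proof (rule tendsto_sandwich[where f = "\<lambda>_. 0"])
      show "((\<lambda>x::real. real (card (exceptional (nat \<lfloor>x\<rfloor>))) / real (nat \<lfloor>x\<rfloor>)) \<longlongrightarrow> 0) at_top"
        using filterlim_compose[OF exceptional_density_0 lim] .
      show "eventually (\<lambda>x. real (card {n::nat. 3 \<le> n \<and> real n \<le> x \<and>
        real (carmichael_L n) < L_const * ln (ln (real n))}) / x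
          \<le> real (card (exceptional (nat \<lfloor>x\<rfloor>))) / real (nat \<lfloor>x\<rfloor>)) at_top"
        using eventually_ge_at_top[of 1]
      proof eventually_elim
        case (elim x)
        \<comment> \<open>For \<open>x \<ge> 1\<close> the integer part is positive and at most
          \<open>x\<close>, so dividing by it only enlarges the quotient.\<close>
        thus ?case unfolding eq[OF elim] by (intro frac_le) auto
      qed
      show "eventually (\<lambda>x. 0 \<le> real (card {n::nat. 3 \<le> n \<and> real n \<le> x \<and>
        real (carmichael_L n) < L_const * ln (ln (real n))}) / x) at_top"
        using eventually_ge_at_top[of 0] by eventually_elim simp
    qed auto
    show "eventually (\<lambda>x :: real. x \<noteq> 0) at_top"
      using eventually_gt_at_top[of 0] by eventually_elim simp
  qed
qed

end
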